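(* Consider a noisy Haar-random circuit of depth $d$ on $n$ qubits on any parallel circuit architecture, with heralded dephasing noise at rate $p$ with dephasing parameter $q$. Then $$\mathbb E_{\mathcal B}[\delta]\;<\;\frac{3^{2/3}}{2}\,n^{1/3}\,e^{-\gamma p d/3},\qquad \gamma=\frac{8q(1-q)}{3},$$ where $\delta$ is the total variation distance between the output distribution and the uniform distribution on $\{0,1\}^n$.
   Context: A depth-$d$ noisy circuit on $n$ qubits is the channel $\mathcal N_d=\mathcal E_d\circ\mathcal C_d\circ\cdots\circ\mathcal E_1\circ\mathcal C_1$, where $\mathcal C_m(\rho)=U_m\rho U_m^\dagger$ is a unitary layer and $\mathcal E_m$ is a noise channel. The circuit is Haar random if each $U_m$ is a tensor product of independent Haar-random two-qubit gates. A parallel architecture is one in which $n$ is even and every qubit takes part in exactly one two-qubit gate in every layer; the pairing of qubits is fixed in advance but otherwise arbitrary and may change from layer to layer. The initial state is $|0\cdots0\rangle\langle 0\cdots 0|$ and all qubits are measured in the computational basis at the end. Heralded dephasing noise at rate $p\in[0,1]$ with dephasing parameter $q\in[0,1]$: after each layer, each site is selected independently with probability $p$ (independently over sites and layers, and independently of the gates), and on each selected site $i$ the channel $\rho\mapsto(1-q)\rho+qZ_i\rho Z_i$ is applied. The noise locations are known, so for each realization of gates and noise locations there is an output distribution $\mathcal D$. The random noise locations are absorbed into the ensemble: $\mathbb E_{\mathcal B}$ is the expectation over both the random gates and the random noise locations. $\delta=\|\mathcal D-\mathcal U\|_{\mathrm{TVD}}=\max_{S\subseteq\{0,1\}^n}|\mathcal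 D(S)-\mathcal U(S)|$, where $\mathcal U$ is the uniform distribution on $\{0,1\}^n$ and $\mathcal D(x)=\langle x|\mathcal N_d(|0\cdots0\rangle\langle0\cdots0|)|x\rangle$ for the given gates and noise locations. *)

theory Defs
  imports "HOL-Probability.Probability"
begin

text \<open>Qubits are indexed by a finite type \<open>'n\<close>, so the number of qubits is \<open>CARD('n)\<close>; a computational
  basis state is a bit string \<open>'n \<Rightarrow> bool\<close>, with \<open>False\<close> for 0 and \<open>True\<close> for 1.\<close>

type_synonym 'n bits = "'n \<Rightarrow> bool"
type_synonym 'n operator = "complex ^ ('n bits) ^ ('n bits)"
type_synonym gate = "complex ^ (bool \<times> bool) ^ (bool \<times> bool)"

definition dagger :: "complex ^ 'a ^ 'a \<Rightarrow> complex ^ 'a ^ 'a" where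
  "dagger A = (\<chi> x y. cnj (A $ y $ x))"

definition unitary_group :: "(complex ^ 'a::finite ^ 'a) set" where
  "unitary_group = {A. dagger A ** A = mat 1 \<and> A ** dagger A = mat 1}"

definition haar_measure :: "(complex ^ 'a::finite ^ 'a) measure \<Rightarrow> bool" where
  "haar_measure \<mu> \<longleftrightarrow>
     prob_space \<mu> \<and> sets \<mu> = sets (restrict_space borel unitary_group) \<and>
     (\<forall>V\<in>unitary_group. distr \<mu> \<mu> (\<lambda>W. V ** W) = \<mu> \<and> distr \<mu> \<mu> (\<lambda>W. W ** V) = \<mu>)"

text \<open>A layer of a parallel architecture: each qubit belongs to exactly one pair. The order inside
  a pair \<open>(i, j)\<close> only records which qubit is the first tensor factor of the gate.\<close>

definition perfect_pairing :: "('n \<times> 'n) set \<Rightarrow> bool" where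
  "perfect_pairing P \<longleftrightarrow>
     (\<forall>(i, j)\<in>P. i \<noteq> j) \<and> (\<forall>k. \<exists>!e. e \<in> P \<and> (k = fst e \<or> k = snd e))"

text \<open>The matrix entries of the tensor product of the gates \<open>g (i, j)\<close>, each acting on the
  tensor factors \<open>i\<close> and \<open>j\<close>.\<close>

definition layer_unitary :: "('n::finite \<times> 'n) set \<Rightarrow> ('n \<times> 'n \<Rightarrow> gate) \<Rightarrow> 'n operator" where
  "layer_unitary P g = (\<chi> x y. \<Prod>(i, j)\<in>P. g (i, j) $ (x i, x j) $ (y i, y j))"

definition unitary_channel :: "'n::finite operator \<Rightarrow> 'n operator \<Rightarrow> 'n operator" where
  "unitary_channel U \<rho> = U ** \<rho> ** dagger U"

definition pauli_Z :: "'n::finite \<Rightarrow> 'n operator" where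
  "pauli_Z i = (\<chi> x y. if x = y then (if x i then - 1 else 1) else 0)"

definition dephase :: "real \<Rightarrow> 'n::finite \<Rightarrow> 'n operator \<Rightarrow> 'n operator" where
  "dephase q i \<rho> = (1 - q) *\<^sub>R \<rho> + q *\<^sub>R (pauli_Z i ** \<rho> ** pauli_Z i)"

lemma pauli_Z_conj_nth:
  "(pauli_Z i ** \<rho> ** pauli_Z i) $ x $ y =
     (if x i then - 1 else 1) * (if y i then - 1 else 1) * \<rho> $ x $ y"
proof -
  define s :: "'a bits \<Rightarrow> complex" where "s = (\<lambda>x. if x i then - 1 else 1)"
  have Z: "pauli_Z i $ x $ y = (if x = y then s x else 0)" for x y
    by (simp add: pauli_Z_def s_def)
  have left: "(pauli_Z i ** \<rho>) $ x $ z = s x * \<rho> $ x $ z" for z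
  proof -
    have "(pauli_Z i ** \<rho>) $ x $ z = (\<Sum>k\<in>UNIV. if x = k then s x * \<rho> $ k $ z else 0)"
      by (simp only: matrix_matrix_mult_def vec_lambda_beta Z, rule sum.cong) auto
    then show ?thesis by (simp only: sum.delta' finite UNIV_I if_True)
  qed
  have "(pauli_Z i ** \<rho> ** pauli_Z i) $ x $ y =
      (\<Sum>k\<in>UNIV. (pauli_Z i ** \<rho>) $ x $ k * pauli_Z i $ k $ y)"
    by (simp only: matrix_matrix_mult_def[of "pauli_Z i ** \<rho>"] vec_lambda_beta)
  also have "\<dots> = (\<Sum>k\<in>UNIV. if k = y then s x * \<rho> $ x $ k * s k else 0)"
    by (simp only: left Z, rule sum.cong) auto
  also have "\<dots> = s x * s y * \<rho> $ x $ y"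
    by (simp only: sum.delta finite UNIV_I if_True mult_ac)
  finally show ?thesis by (simp only: s_def)
qed

text \<open>Hence the fold below does not depend on the order of the sites.\<close>

lemma comp_fun_commute_dephase: "comp_fun_commute (dephase q)"
proof
  fix i j :: 'a
  have "dephase q i (dephase q j \<rho>) $ x $ y = dephase q j (dephase q i \<rho>) $ x $ y" for \<rho> x y
    unfolding dephase_def vector_add_component vector_scaleR_component pauli_Z_conj_nth
    by (simp add: algebra_simps)
  then show "dephase q j \<circ> dephase q i = dephase q i \<circ> dephase q j"
    by (simp only: fun_eq_iff vec_eq_iff comp_apply) simp
qed

definition dephase_sites :: "real \<Rightarrow> 'n::finite set \<Rightarrow> 'n operator \<Rightarrow> 'n operator" where
  "dephase_sites q S \<rho> = Finite_Set.fold (dephase q) \<rho> S"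

text \<open>Layers are numbered \<open>0, \<dots>, d - 1\<close>: \<open>u (m, e)\<close> is the gate on the pair \<open>e\<close> in layer \<open>m\<close>, and
  \<open>b (m, i)\<close> says whether site \<open>i\<close> is selected for noise after layer \<open>m\<close>.\<close>

primrec noisy_circuit :: "real \<Rightarrow> (nat \<Rightarrow> ('n::finite \<times> 'n) set) \<Rightarrow>
    (nat \<times> 'n \<times> 'n \<Rightarrow> gate) \<Rightarrow> (nat \<times> 'n \<Rightarrow> bool) \<Rightarrow> nat \<Rightarrow> 'n operator \<Rightarrow> 'n operator" where
  "noisy_circuit q P u b 0 \<rho> = \<rho>"
| "noisy_circuit q P u b (Suc m) \<rho> =
     dephase_sites q {i. b (m, i)}
       (unitary_channel (layer_unitary (P m) (\<lambda>e. u (m, e))) (noisy_circuit q P u b m \<rho>))"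

definition zero_state :: "'n::finite operator" where
  "zero_state = (\<chi> x y. if x = (\<lambda>_. False) \<and> y = (\<lambda>_. False) then 1 else 0)"

text \<open>The diagonal entries are real because the circuit preserves Hermiticity.\<close>

definition output_dist :: "real \<Rightarrow> (nat \<Rightarrow> ('n::finite \<times> 'n) set) \<Rightarrow>
    nat \<Rightarrow> (nat \<times> 'n \<times> 'n \<Rightarrow> gate) \<Rightarrow> (nat \<times> 'n \<Rightarrow> bool) \<Rightarrow> 'n bits \<Rightarrow> real" where
  "output_dist q P d u b x = Re (noisy_circuit q P u b d zero_state $ x $ x)"

definition uniform_dist :: "'n::finite bits \<Rightarrow> real" where
  "uniform_dist x = 1 / 2 ^ CARD('n)"

definition tv_dist :: "('a::finite \<Rightarrow> real) \<Rightarrow> ('a \<Rightarrow> real) \<Rightarrow> real" where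
  "tv_dist D E = (MAX S. \<bar>(\<Sum>x\<in>S. D x) - (\<Sum>x\<in>S. E x)\<bar>)"

text \<open>The joint law of the gates (independent, each distributed as \<open>\<mu>\<close>) and of the noise locations
  (independent, each selected with probability \<open>p\<close>).\<close>

definition circuit_ensemble :: "gate measure \<Rightarrow> real \<Rightarrow> (nat \<Rightarrow> ('n::finite \<times> 'n) set) \<Rightarrow> nat \<Rightarrow>
    ((nat \<times> 'n \<times> 'n \<Rightarrow> gate) \<times> (nat \<times> 'n \<Rightarrow> bool)) measure" where
  "circuit_ensemble \<mu> p P d =
     (\<Pi>\<^sub>M k\<in>(SIGMA m:{..<d}. P m). \<mu>) \<Otimes>\<^sub>M
     (\<Pi>\<^sub>M k\<in>{..<d} \<times> UNIV. measure_pmf (bernoulli_pmf p))"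

end

theory Submission
  imports Defs
begin

text \<open>
  Expand the state in Pauli strings, with coefficients \<open>c\<^sub>P = tr (P \<rho>)\<close>. Averaged over Haar-random
  gates, the squares \<open>\<bar>c\<^sub>P\<bar>\<^sup>2\<close> evolve linearly: every non-identity Pauli operator on a pair is spread
  uniformly over the 15 non-identity ones. A dephasing event then multiplies by \<open>(1 - 2q)\<^sup>2\<close> for each
  \<open>X\<close> or \<open>Y\<close> on the selected site, which averages to the damping factor \<open>f = 1 - 4pq(1 - q)\<close>.
  The key invariant is that after \<open>m\<close> layers the total weight \<open>\<phi>\<^sub>m(A)\<close> of the strings supported in
  any set \<open>A\<close> of sites is at most \<open>(1 + \<kappa>\<^bsup>m\<^esup>)\<^bsup>card A\<^esup>\<close> with \<open>\<kappa> = 1 - 2(1 - f)/3 = 1 - \<gamma>p\<close>. It is preserved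
  for an arbitrary pairing, because \<open>\<phi>\<^sub>m\<^sub>+\<^sub>1(A)\<close> is a convex combination of the values of \<open>\<phi>\<^sub>m\<close> on
  unions of pairs. Hence the second moment of the non-identity coefficients is at most
  \<open>e\<^bsup>x\<^esup> - 1\<close> with \<open>x = n e\<^bsup>-\<gamma>pd\<^esup>\<close>, and Cauchy-Schwarz gives \<open>E \<delta> \<le> sqrt (e\<^bsup>x\<^esup> - 1) / 2\<close>. For \<open>x < 1\<close> this is
  smaller than the claimed bound, and for \<open>x \<ge> 1\<close> the claimed bound exceeds 1.
\<close>

section \<open>Pauli matrices and Haar-random two-qubit gates\<close>

lemma sum_fun_prod:
  fixes f :: "'a::finite \<Rightarrow> 'b::finite \<Rightarrow> 'c::comm_semiring_1"
  shows "(\<Sum>g\<in>UNIV. \<Prod>x\<in>UNIV. f x (g x)) = (\<Prod>x\<in>UNIV. \<Sum>y\<in>UNIV. f x y)"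
  by (subst prod_sum_PiE) (auto simp: PiE_UNIV_domain)

lemma sum_UNIV_pair:
  fixes f :: "'b::finite \<times> 'c::finite \<Rightarrow> 'a::comm_monoid_add"
  shows "(\<Sum>p\<in>UNIV. f p) = (\<Sum>a\<in>UNIV. \<Sum>b\<in>UNIV. f (a, b))"
  by (simp add: UNIV_Times_UNIV[symmetric] sum.cartesian_product del: UNIV_Times_UNIV)

text \<open>The pair \<open>(a, b)\<close> encodes the Hermitian Pauli matrix \<open>\<i>\<^bsup>ab\<^esup> X\<^bsup>a\<^esup> Z\<^bsup>b\<^esup>\<close>.\<close>

definition pauli_entry :: "bool \<times> bool \<Rightarrow> bool \<Rightarrow> bool \<Rightarrow> complex" where
  "pauli_entry p x y = (if x = (y \<noteq> fst p)
     then (if fst p \<and> snd p then \<i> else 1) * (if snd p \<and> y then - 1 else 1) else 0)"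

lemma pauli_entry_hermitian: "cnj (pauli_entry p x y) = pauli_entry p y x"
  by (cases p) (auto simp: pauli_entry_def)

lemma pauli_entry_square:
  "(\<Sum>k\<in>UNIV. pauli_entry p x k * pauli_entry p k y) = of_bool (x = y)"
  by (cases p) (auto simp: pauli_entry_def UNIV_bool)

text \<open>The symplectic form, over the field with two elements, on the encoding by pairs of bits.
  Two Pauli matrices always commute up to a sign, and this form is that sign.\<close>

definition pauli_anticommuting :: "bool \<times> bool \<Rightarrow> bool \<times> bool \<Rightarrow> bool" where
  "pauli_anticommuting p q \<longleftrightarrow> (fst p \<and> snd q) \<noteq> (snd p \<and> fst q)"

lemma pauli_entry_commute:
  "(\<Sum>k\<in>UNIV. pauli_entry p x k * pauli_entry q k y) =
   (if pauli_anticommuting p q then - 1 else 1) * (\<Sum>k\<in>UNIV. pauli_entry q x k * pauli_entry p k y)"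
  by (cases p; cases q) (auto simp: pauli_entry_def pauli_anticommuting_def UNIV_bool)

lemma pauli_entry_trace:
  "(\<Sum>x\<in>UNIV. \<Sum>y\<in>UNIV. pauli_entry p x y * cnj (pauli_entry q x y)) = 2 * of_bool (p = q)"
  by (cases p; cases q) (auto simp: pauli_entry_def UNIV_bool)

text \<open>Dual to \<open>pauli_entry_trace\<close>: the Pauli matrices, read as vectors of four
  entries, form an orthogonal basis, so distinct matrix positions are orthogonal across the four
  matrices as well.\<close>

lemma pauli_entry_complete:
  "(\<Sum>p\<in>UNIV. pauli_entry p x y * cnj (pauli_entry p x' y')) = 2 * of_bool (x = x' \<and> y = y')"
  by (auto simp: pauli_entry_def UNIV_bool sum_UNIV_pair)

type_synonym pauli2 = "(bool \<times> bool) \<times> (bool \<times> bool)"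

abbreviation pauli_id :: "bool \<times> bool" where "pauli_id \<equiv> (False, False)"

definition pauli_pair :: "pauli2 \<Rightarrow> gate" where
  "pauli_pair p = (\<chi> x y. pauli_entry (fst p) (fst x) (fst y) * pauli_entry (snd p) (snd x) (snd y))"

lemma pauli_pair_mult_nth:
  "(pauli_pair p ** pauli_pair q) $ x $ y =
     (\<Sum>k\<in>UNIV. pauli_entry (fst p) (fst x) k * pauli_entry (fst q) k (fst y)) *
     (\<Sum>k\<in>UNIV. pauli_entry (snd p) (snd x) k * pauli_entry (snd q) k (snd y))"
  by (simp add: matrix_matrix_mult_def pauli_pair_def sum_UNIV_pair sum_product mult_ac)

lemma pauli_pair_square: "pauli_pair p ** pauli_pair p = mat 1"
  by (simp add: vec_eq_iff pauli_pair_mult_nth pauli_entry_square mat_def prod_eq_iff)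

lemma dagger_pauli_pair: "dagger (pauli_pair p) = pauli_pair p"
  by (simp add: vec_eq_iff dagger_def pauli_pair_def pauli_entry_hermitian)

text \<open>The signs of the two tensor factors multiply, hence the exclusive or.\<close>

definition pauli_pair_anticommuting :: "pauli2 \<Rightarrow> pauli2 \<Rightarrow> bool" where
  "pauli_pair_anticommuting p q \<longleftrightarrow> pauli_anticommuting (fst p) (fst q) \<noteq> pauli_anticommuting (snd p) (snd q)"

lemma pauli_pair_anticommute:
  assumes "pauli_pair_anticommuting p q"
  shows "pauli_pair p ** pauli_pair q = - (pauli_pair q ** pauli_pair p)"
  unfolding vec_eq_iff vector_uminus_component pauli_pair_mult_nth
  using assms
  by (simp add: pauli_entry_commute[of "fst p" _ "fst q"] pauli_entry_commute[of "snd p" _ "snd q"]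
      pauli_pair_anticommuting_def)

text \<open>Distinct non-identity Pauli matrices anticommute. If \<open>p\<close> and
  \<open>q\<close> differ, the third one serves; if they agree, either of the other two
  does.\<close>

lemma ex_pauli_anticommuting:
  assumes "p \<noteq> pauli_id" "q \<noteq> pauli_id"
  shows "\<exists>s. pauli_anticommuting p s \<and> pauli_anticommuting s q"
  using assms by (cases p; cases q) (auto simp: pauli_anticommuting_def split_paired_Ex ex_bool_eq)

lemma pauli_anticommuting_id [simp]: "\<not> pauli_anticommuting pauli_id s" "\<not> pauli_anticommuting s pauli_id"
  by (auto simp: pauli_anticommuting_def)

text \<open>Two non-identity operators on a pair may commute, so an intermediate \<open>s\<close>
  links them in two anticommuting steps. If both are nontrivial on a common site, \<open>s\<close>
  acts there only; otherwise they sit on different sites and \<open>s\<close> needs a factor on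
  each.\<close>

lemma ex_pauli_pair_anticommuting:
  assumes "p \<noteq> (pauli_id, pauli_id)" "q \<noteq> (pauli_id, pauli_id)"
  shows "\<exists>s. pauli_pair_anticommuting p s \<and> pauli_pair_anticommuting s q"
proof -
  obtain p1 p2 q1 q2 where pq: "p = (p1, p2)" "q = (q1, q2)" by (cases p; cases q)
  consider "p1 \<noteq> pauli_id" "q1 \<noteq> pauli_id" | "p2 \<noteq> pauli_id" "q2 \<noteq> pauli_id"
    | "p1 \<noteq> pauli_id" "q2 \<noteq> pauli_id" "p2 = pauli_id" "q1 = pauli_id"
    | "p2 \<noteq> pauli_id" "q1 \<noteq> pauli_id" "p1 = pauli_id" "q2 = pauli_id"
    using assms pq by blast
  then show ?thesis
  proof cases
    case 1
    then obtain s where "pauli_anticommuting p1 s" "pauli_anticommuting s q1" using ex_pauli_anticommuting by blast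
    then have "pauli_pair_anticommuting p (s, pauli_id) \<and> pauli_pair_anticommuting (s, pauli_id) q"
      by (simp add: pauli_pair_anticommuting_def pq)
    then show ?thesis by blast
  next
    case 2
    then obtain s where "pauli_anticommuting p2 s" "pauli_anticommuting s q2" using ex_pauli_anticommuting by blast
    then have "pauli_pair_anticommuting p (pauli_id, s) \<and> pauli_pair_anticommuting (pauli_id, s) q"
      by (simp add: pauli_pair_anticommuting_def pq)
    then show ?thesis by blast
  next
    case 3
    obtain s where "pauli_anticommuting p1 s" using 3 ex_pauli_anticommuting by blast
    moreover obtain t where "pauli_anticommuting t q2" using 3 ex_pauli_anticommuting by blast
    ultimately have "pauli_pair_anticommuting p (s, t) \<and> pauli_pair_anticommuting (s, t) q"
      by (simp add: pauli_pair_anticommuting_def pq 3)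
    then show ?thesis by blast
  next
    case 4
    obtain s where "pauli_anticommuting p2 s" using 4 ex_pauli_anticommuting by blast
    moreover obtain t where "pauli_anticommuting t q1" using 4 ex_pauli_anticommuting by blast
    ultimately have "pauli_pair_anticommuting p (t, s) \<and> pauli_pair_anticommuting (t, s) q"
      by (simp add: pauli_pair_anticommuting_def pq 4)
    then show ?thesis by blast
  qed
qed

section \<open>Adjoints, unitary matrices and conjugation of one Pauli operator into another\<close>

lemma dagger_dagger: "dagger (dagger A) = A"
  by (simp add: dagger_def vec_eq_iff)

lemma dagger_mult: "dagger (A ** B) = dagger B ** dagger A"
  by (simp add: dagger_def vec_eq_iff matrix_matrix_mult_def mult.commute)

lemma dagger_add: "dagger (A + B) = dagger A + dagger B"
  by (simp add: dagger_def vec_eq_iff)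

lemma dagger_scaleR: "dagger (c *\<^sub>R A) = c *\<^sub>R dagger A"
  by (simp add: dagger_def vec_eq_iff)

lemma unitary_group_mult: "A \<in> unitary_group \<Longrightarrow> B \<in> unitary_group \<Longrightarrow> A ** B \<in> unitary_group"
proof -
  assume A: "A \<in> unitary_group" and B: "B \<in> unitary_group"
  have "dagger B ** dagger A ** (A ** B) = dagger B ** (dagger A ** A) ** B"
    by (simp only: matrix_mul_assoc)
  moreover have "A ** B ** (dagger B ** dagger A) = A ** (B ** dagger B) ** dagger A"
    by (simp only: matrix_mul_assoc)
  ultimately show ?thesis
    using A B by (simp add: unitary_group_def dagger_mult)
qed

lemma matrix_add_rdistrib: "(A + B) ** C = A ** C + B ** (C :: 'a::semiring_1 ^ 'n ^ 'm)"
  by (simp add: vec_eq_iff matrix_matrix_mult_def distrib_right sum.distrib)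

text \<open>For anticommuting Hermitian involutions \<open>A\<close> and \<open>B\<close>, the unitary \<open>(A + B) / \<surd>2\<close> conjugates
  \<open>A\<close> to \<open>B\<close>.\<close>

lemma conjugate_anticommuting:
  assumes "pauli_pair_anticommuting p q"
  obtains V where "V \<in> unitary_group" "dagger V ** pauli_pair p ** V = pauli_pair q"
proof
  define A where "A = pauli_pair p"
  define B where "B = pauli_pair q"
  define V where "V = (1 / sqrt 2) *\<^sub>R (A + B)"
  have A: "A ** A = mat 1" "dagger A = A" and B: "B ** B = mat 1" "dagger B = B"
    by (simp_all add: A_def B_def pauli_pair_square dagger_pauli_pair)
  have AB: "A ** B = - (B ** A)"
    using assms by (simp add: A_def B_def pauli_pair_anticommute)
  have dV: "dagger V = V"
    by (simp add: V_def dagger_scaleR dagger_add A B)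
  have VV: "V ** V = mat 1"
  proof -
    have "V ** V = (1 / 2) *\<^sub>R ((A + B) ** (A + B))"
      by (simp add: V_def scalar_matrix_assoc[symmetric] matrix_scalar_ac)
    \<comment> \<open>The cross terms \<open>A ** B\<close> and \<open>B ** A\<close>
      cancel.\<close>
    also have "(A + B) ** (A + B) = 2 *\<^sub>R mat 1"
      by (simp add: matrix_add_rdistrib matrix_add_ldistrib A B AB scaleR_2)
    finally show ?thesis by simp
  qed
  show "V \<in> unitary_group" by (simp add: unitary_group_def dV VV)
  have AAB: "A ** A ** B = B" by (simp add: A)
  \<comment> \<open>Since \<open>A\<close> and \<open>B\<close> are involutions,
    \<open>V ** A\<close> and \<open>B ** V\<close> both equal \<open>mat 1 + B ** A\<close> up to
    the factor \<open>1 / sqrt 2\<close>.\<close>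
  have "V ** A = (1 / sqrt 2) *\<^sub>R (mat 1 + B ** A)"
    by (simp add: V_def scalar_matrix_assoc[symmetric] matrix_add_rdistrib A)
  also have "B ** A = - (A ** B)" by (simp add: AB)
  finally have "V ** A = (1 / sqrt 2) *\<^sub>R (B ** B + - (A ** B))" by (simp add: B)
  moreover have "B ** V = (1 / sqrt 2) *\<^sub>R (B ** A + B ** B)"
    by (simp add: V_def matrix_scalar_ac scalar_matrix_assoc[symmetric] matrix_add_ldistrib scaleR_right_distrib)
  ultimately have "V ** A = B ** V" by (simp add: AB)
  then have "V ** A ** V = B ** (V ** V)" by (simp add: matrix_mul_assoc)
  then show "dagger V ** pauli_pair p ** V = pauli_pair q"
    by (simp add: dV VV A_def[symmetric] B_def[symmetric])
qed

section \<open>Pauli transfer matrix of a two-qubit gate\<close>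

text \<open>The matrix of conjugation by \<open>u\<close> in the Pauli basis. Division by 4, the
  dimension of the pair, makes its columns orthonormal for unitary \<open>u\<close>.\<close>

definition gate_transfer :: "gate \<Rightarrow> pauli2 \<Rightarrow> pauli2 \<Rightarrow> complex" where
  "gate_transfer u p q = trace (pauli_pair p ** (u ** pauli_pair q ** dagger u)) / 4"

text \<open>Parseval's identity: expand both factors and sum over \<open>p\<close> first. The family
  \<open>b\<close> is abstract so that it covers Pauli operators on pairs as well as Pauli
  strings.\<close>

lemma complete_system_parseval:
  fixes b :: "'i::finite \<Rightarrow> 'z::finite \<Rightarrow> complex"
  assumes "\<And>z z'. (\<Sum>p\<in>UNIV. b p z * cnj (b p z')) = c * of_bool (z = z')"
  shows "(\<Sum>p\<in>UNIV. (\<Sum>z\<in>UNIV. b p z * f z) * cnj (\<Sum>z\<in>UNIV. b p z * g z)) =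
    c * (\<Sum>z\<in>UNIV. f z * cnj (g z))"
proof -
  have "(\<Sum>p\<in>UNIV. (\<Sum>z\<in>UNIV. b p z * f z) * cnj (\<Sum>z\<in>UNIV. b p z * g z)) =
    (\<Sum>p\<in>UNIV. \<Sum>z\<in>UNIV. \<Sum>z'\<in>UNIV. f z * cnj (g z') * (b p z * cnj (b p z')))"
    by (simp add: sum_product mult_ac)
  also have "\<dots> = (\<Sum>z\<in>UNIV. \<Sum>p\<in>UNIV. \<Sum>z'\<in>UNIV. f z * cnj (g z') * (b p z * cnj (b p z')))"
    by (rule sum.swap)
  also have "\<dots> = (\<Sum>z\<in>UNIV. \<Sum>z'\<in>UNIV. \<Sum>p\<in>UNIV. f z * cnj (g z') * (b p z * cnj (b p z')))"
    by (intro sum.cong refl sum.swap)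
  also have "\<dots> = (\<Sum>z\<in>UNIV. \<Sum>z'\<in>UNIV. f z * cnj (g z') * (c * of_bool (z = z')))"
    by (simp only: sum_distrib_left[symmetric] assms)
  also have "\<dots> = c * (\<Sum>z\<in>UNIV. f z * cnj (g z))"
    by (simp add: of_bool_def if_distrib sum_distrib_left mult_ac cong: if_cong)
  finally show ?thesis .
qed

lemma complete_system_expansion:
  fixes b :: "'i::finite \<Rightarrow> 'z::finite \<Rightarrow> complex"
  assumes "\<And>z z'. (\<Sum>p\<in>UNIV. b p z * cnj (b p z')) = c * of_bool (z = z')"
  shows "(\<Sum>p\<in>UNIV. cnj (b p z') * (\<Sum>z\<in>UNIV. b p z * f z)) = c * f z'"
proof -
  have "(\<Sum>p\<in>UNIV. cnj (b p z') * (\<Sum>z\<in>UNIV. b p z * f z)) =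
    (\<Sum>p\<in>UNIV. \<Sum>z\<in>UNIV. f z * (b p z * cnj (b p z')))"
    by (simp add: sum_distrib_left mult_ac)
  also have "\<dots> = (\<Sum>z\<in>UNIV. \<Sum>p\<in>UNIV. f z * (b p z * cnj (b p z')))"
    by (rule sum.swap)
  also have "\<dots> = (\<Sum>z\<in>UNIV. f z * (c * of_bool (z = z')))"
    by (simp only: sum_distrib_left[symmetric] assms)
  also have "\<dots> = c * f z'"
    by (simp add: of_bool_def if_distrib mult_ac cong: if_cong)
  finally show ?thesis .
qed

text \<open>A single index \<open>z\<close> for matrix positions brings traces into the form of the
  two complete-system lemmas.\<close>

lemma trace_mult_sum: "trace (A ** B) = (\<Sum>z\<in>UNIV. A $ fst z $ snd z * B $ snd z $ fst z)"
  by (simp add: trace_def matrix_matrix_mult_def sum_UNIV_pair)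

lemma pauli_pair_complete:
  "(\<Sum>p\<in>UNIV. pauli_pair p $ fst z $ snd z * cnj (pauli_pair p $ fst z' $ snd z')) = 4 * of_bool (z = z')"
proof -
  have "(\<Sum>p\<in>UNIV. pauli_pair p $ fst z $ snd z * cnj (pauli_pair p $ fst z' $ snd z')) =
    (\<Sum>p\<in>UNIV. pauli_entry p (fst (fst z)) (fst (snd z)) * cnj (pauli_entry p (fst (fst z')) (fst (snd z')))) *
    (\<Sum>p\<in>UNIV. pauli_entry p (snd (fst z)) (snd (snd z)) * cnj (pauli_entry p (snd (fst z')) (snd (snd z'))))"
    by (simp only: pauli_pair_def sum_UNIV_pair[where 'b="bool \<times> bool" and 'c="bool\<times>bool"] sum_product
        vec_lambda_beta fst_conv snd_conv complex_cnj_mult mult_ac)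
  then show ?thesis by (auto simp: pauli_entry_complete prod_eq_iff)
qed

lemma pauli_pair_parseval:
  "(\<Sum>p\<in>UNIV. trace (pauli_pair p ** A) * cnj (trace (pauli_pair p ** B))) = 4 * trace (A ** dagger B)"
proof -
  have "trace (A ** dagger B) = (\<Sum>z\<in>UNIV. A $ snd z $ fst z * cnj (B $ snd z $ fst z))"
    unfolding trace_mult_sum sum_UNIV_pair[where 'b="bool\<times>bool" and 'c="bool\<times>bool"]
    by (subst sum.swap) (simp add: dagger_def)
  then show ?thesis
    unfolding trace_mult_sum complete_system_parseval[OF pauli_pair_complete] by simp
qed

lemma trace_pauli_pair_mult: "trace (pauli_pair p ** pauli_pair q) = 4 * of_bool (p = q)"
proof -
  have "trace (pauli_pair p ** pauli_pair q) =
    (\<Sum>x\<in>UNIV. \<Sum>y\<in>UNIV. pauli_entry (fst p) x y * pauli_entry (fst q) y x) *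
    (\<Sum>x\<in>UNIV. \<Sum>y\<in>UNIV. pauli_entry (snd p) x y * pauli_entry (snd q) y x)"
    by (simp add: trace_def pauli_pair_mult_nth sum_UNIV_pair sum_product)
  then show ?thesis
    by (auto simp: pauli_entry_trace[unfolded pauli_entry_hermitian] prod_eq_iff)
qed

lemma pauli_pair_id: "pauli_pair (pauli_id, pauli_id) = mat 1"
  by (auto simp: pauli_pair_def pauli_entry_def vec_eq_iff mat_def prod_eq_iff)

lemma trace_unitary_conj:
  assumes "u \<in> unitary_group"
  shows "trace (u ** A ** dagger u) = trace A"
proof -
  have "trace (u ** A ** dagger u) = trace (dagger u ** u ** A)"
    using trace_mul_sym[of "u ** A" "dagger u"] by (simp add: matrix_mul_assoc)
  then show ?thesis using assms by (simp add: unitary_group_def)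
qed

text \<open>Conjugation by a unitary preserves the trace, so no non-identity operator acquires an
  identity component.\<close>

lemma gate_transfer_id:
  assumes "u \<in> unitary_group"
  shows "gate_transfer u (pauli_id, pauli_id) q = of_bool (q = (pauli_id, pauli_id))"
proof -
  have "gate_transfer u (pauli_id, pauli_id) q = trace (pauli_pair q ** pauli_pair (pauli_id, pauli_id)) / 4"
    by (simp add: gate_transfer_def pauli_pair_id trace_unitary_conj assms)
  then show ?thesis by (simp add: trace_pauli_pair_mult)
qed

text \<open>Conjugation by a unitary preserves the Hilbert-Schmidt inner product, which Parseval's
  identity expresses through Pauli coefficients.\<close>

lemma gate_transfer_orthonormal:
  assumes "u \<in> unitary_group"
  shows "(\<Sum>p\<in>UNIV. gate_transfer u p q * cnj (gate_transfer u p q')) = of_bool (q = q')"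
proof -
  have "(u ** pauli_pair q ** dagger u) ** dagger (u ** pauli_pair q' ** dagger u) =
    u ** pauli_pair q ** (dagger u ** u) ** pauli_pair q' ** dagger u"
    by (simp only: dagger_mult dagger_dagger dagger_pauli_pair matrix_mul_assoc)
  also have "\<dots> = u ** (pauli_pair q ** pauli_pair q') ** dagger u"
    using assms by (simp add: unitary_group_def matrix_mul_assoc)
  \<comment> \<open>One factor 4 comes from \<open>pauli_pair_parseval\<close> and one from
    \<open>trace_pauli_pair_mult\<close>; the two divisions by 4 in \<open>gate_transfer\<close>
    cancel the resulting 16.\<close>
  finally have "(\<Sum>p\<in>UNIV. trace (pauli_pair p ** (u ** pauli_pair q ** dagger u)) *
      cnj (trace (pauli_pair p ** (u ** pauli_pair q' ** dagger u)))) = 16 * of_bool (q = q')"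
    by (simp add: pauli_pair_parseval trace_unitary_conj assms trace_pauli_pair_mult)
  then show ?thesis
    by (simp add: gate_transfer_def sum_divide_distrib[symmetric])
qed

lemma norm_gate_transfer_le:
  assumes "u \<in> unitary_group"
  shows "norm (gate_transfer u p q) \<le> 1"
proof -
  have "(\<Sum>p\<in>UNIV. (norm (gate_transfer u p q))\<^sup>2) = 1"
    using gate_transfer_orthonormal[OF assms, of q q]
    by (simp add: complex_norm_square[symmetric] flip: of_real_power of_real_sum)
  moreover have "(norm (gate_transfer u p q))\<^sup>2 \<le> (\<Sum>p\<in>UNIV. (norm (gate_transfer u p q))\<^sup>2)"
    by (rule member_le_sum) auto
  ultimately show ?thesis by (simp add: power_le_one_iff abs_square_le_1)
qed

text \<open>By cyclicity of the trace, left multiplication of the gate acts on the output operator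
  only. This turns invariance of the Haar measure into a symmetry between rows of the transfer
  matrix.\<close>

lemma gate_transfer_conj:
  assumes "dagger V ** pauli_pair p ** V = pauli_pair p'"
  shows "gate_transfer (V ** u) p q = gate_transfer u p' q"
proof -
  have "trace (pauli_pair p ** (V ** u ** pauli_pair q ** dagger (V ** u))) =
    trace (dagger V ** (pauli_pair p ** (V ** u ** pauli_pair q ** dagger u)))"
    using trace_mul_sym[of "pauli_pair p ** (V ** u ** pauli_pair q ** dagger u)" "dagger V"]
    by (simp add: dagger_mult matrix_mul_assoc)
  also have "\<dots> = trace (pauli_pair p' ** (u ** pauli_pair q ** dagger u))"
    by (simp only: matrix_mul_assoc assms[symmetric])
  finally show ?thesis by (simp add: gate_transfer_def)
qed

lemma continuous_gate_transfer: "continuous_on UNIV (\<lambda>u. gate_transfer u p q)"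
  unfolding gate_transfer_def trace_def matrix_matrix_mult_def dagger_def vec_lambda_beta
  by (intro continuous_intros) simp_all

abbreviation gate_transfer2 :: "pauli2 \<Rightarrow> pauli2 \<Rightarrow> pauli2 \<Rightarrow> gate \<Rightarrow> complex" where
  "gate_transfer2 p q q' u \<equiv> gate_transfer u p q * cnj (gate_transfer u p q')"

text \<open>The Haar average of the squared moduli of the transfer matrix; 15 counts the
  non-identity Pauli operators on a pair.\<close>

definition pauli_mixing :: "pauli2 \<Rightarrow> pauli2 \<Rightarrow> real" where
  "pauli_mixing p q = (if p = (pauli_id, pauli_id) \<or> q = (pauli_id, pauli_id) then of_bool (p = q) else 1 / 15)"

lemma pauli_mixing_nonneg: "0 \<le> pauli_mixing p q"
  by (simp add: pauli_mixing_def)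

lemma pauli_mixing_le_1: "pauli_mixing p q \<le> 1"
  by (simp add: pauli_mixing_def)

section \<open>Second moments of the transfer matrix under Haar measure\<close>

context
  fixes \<mu> :: "gate measure"
  assumes haar: "haar_measure \<mu>"
begin

lemma haar_space: "space \<mu> = unitary_group"
  using haar sets_eq_imp_space_eq[of \<mu> "restrict_space borel unitary_group"]
  by (simp add: haar_measure_def space_restrict_space)

lemma haar_measurable_continuous:
  assumes "continuous_on UNIV f"
  shows "f \<in> borel_measurable \<mu>"
proof -
  have "f \<in> borel_measurable (restrict_space borel unitary_group)"
    by (intro measurable_restrict_space1 borel_measurable_continuous_onI assms)
  then show ?thesis
    using haar by (simp add: haar_measure_def cong: measurable_cong_sets)
qed

lemma haar_integrable:
  assumes "f \<in> borel_measurable \<mu>" "\<And>u. u \<in> unitary_group \<Longrightarrow> norm (f u) \<le> B"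
  shows "integrable \<mu> (f :: gate \<Rightarrow> complex)"
proof -
  interpret prob_space \<mu> using haar by (simp add: haar_measure_def)
  show ?thesis
    by (rule integrable_const_bound[where B=B]) (use assms in \<open>auto simp: haar_space\<close>)
qed

lemma haar_translate:
  fixes f :: "gate \<Rightarrow> complex"
  assumes "V \<in> unitary_group" "f \<in> borel_measurable \<mu>"
  shows "(\<integral>u. f (V ** u) \<partial>\<mu>) = (\<integral>u. f u \<partial>\<mu>)"
proof -
  have sets: "sets \<mu> = sets (restrict_space borel unitary_group)"
    using haar by (simp add: haar_measure_def)
  have "(\<lambda>u. V ** u) \<in> restrict_space borel unitary_group \<rightarrow>\<^sub>M restrict_space borel unitary_group"
  proof (rule measurable_restrict_space3)
    show "(**) V \<in> borel_measurable borel"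
      unfolding matrix_matrix_mult_def
      by (intro borel_measurable_continuous_onI continuous_intros)
  qed (use assms unitary_group_mult in auto)
  then have "(\<lambda>u. V ** u) \<in> \<mu> \<rightarrow>\<^sub>M \<mu>"
    by (simp add: sets cong: measurable_cong_sets)
  then have "(\<integral>u. f (V ** u) \<partial>\<mu>) = (\<integral>u. f u \<partial>distr \<mu> \<mu> (\<lambda>u. V ** u))"
    using assms by (simp add: integral_distr)
  also have "distr \<mu> \<mu> (\<lambda>u. V ** u) = \<mu>"
    using haar assms by (simp add: haar_measure_def)
  finally show ?thesis .
qed

lemma gate_transfer2_measurable: "gate_transfer2 p q q' \<in> borel_measurable \<mu>"
  by (intro haar_measurable_continuous continuous_intros continuous_gate_transfer)

lemma gate_transfer2_integrable: "integrable \<mu> (gate_transfer2 p q q')"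
  by (rule haar_integrable[where B=1, OF gate_transfer2_measurable])
     (simp add: norm_mult norm_gate_transfer_le mult_le_one)

text \<open>Translating by the unitary from \<open>conjugate_anticommuting\<close> replaces row
  \<open>p\<close> by row \<open>s\<close>.\<close>

lemma haar_integral_gate_transfer_anticommuting:
  assumes "pauli_pair_anticommuting p s"
  shows "(\<integral>u. gate_transfer2 p q q' u \<partial>\<mu>) = (\<integral>u. gate_transfer2 s q q' u \<partial>\<mu>)"
proof -
  obtain V where V: "V \<in> unitary_group" "dagger V ** pauli_pair p ** V = pauli_pair s"
    using conjugate_anticommuting[OF assms] .
  show ?thesis
    using haar_translate[OF V(1) gate_transfer2_measurable, of p q q'] by (simp add: gate_transfer_conj[OF V(2)])
qed

text \<open>Orthonormality fixes the sum over all rows, and the identity row is known. The other 15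
  rows have equal averages, two anticommuting translations apart, so each gets a fifteenth of the
  remainder. For \<open>q \<noteq> q'\<close> that remainder is 0, which is why cross terms
  vanish.\<close>

lemma haar_integral_gate_transfer:
  "(\<integral>u. gate_transfer2 p q q' u \<partial>\<mu>) = of_real (pauli_mixing p q) * of_bool (q = q')"
proof -
  interpret prob_space \<mu> using haar by (simp add: haar_measure_def)
  let ?I = "(pauli_id, pauli_id)"
  have int_I: "(\<integral>u. gate_transfer2 ?I q q' u \<partial>\<mu>) = of_bool (q = ?I \<and> q' = ?I)"
  proof -
    have "(\<integral>u. gate_transfer2 ?I q q' u \<partial>\<mu>) = (\<integral>u. of_bool (q = ?I \<and> q' = ?I) \<partial>\<mu>)"
      by (rule Bochner_Integration.integral_cong) (auto simp: haar_space gate_transfer_id)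
    then show ?thesis by (simp add: prob_space)
  qed
  show ?thesis
  proof (cases "p = ?I")
    case True
    then show ?thesis using int_I by (auto simp: pauli_mixing_def)
  next
    case False
    have same: "(\<integral>u. gate_transfer2 s q q' u \<partial>\<mu>) = (\<integral>u. gate_transfer2 p q q' u \<partial>\<mu>)" if "s \<noteq> ?I" for s
    proof -
      obtain r where "pauli_pair_anticommuting s r" "pauli_pair_anticommuting r p"
        using ex_pauli_pair_anticommuting[OF \<open>s \<noteq> ?I\<close> False] by blast
      then show ?thesis
        by (simp only: haar_integral_gate_transfer_anticommuting[of s r]
            haar_integral_gate_transfer_anticommuting[of r p])
    qed
    have "(\<Sum>s\<in>UNIV. \<integral>u. gate_transfer2 s q q' u \<partial>\<mu>) = (\<integral>u. (\<Sum>s\<in>UNIV. gate_transfer2 s q q' u) \<partial>\<mu>)"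
      by (rule Bochner_Integration.integral_sum[symmetric]) (rule gate_transfer2_integrable)
    also have "\<dots> = (\<integral>u. of_bool (q = q') \<partial>\<mu>)"
      by (rule Bochner_Integration.integral_cong) (auto simp: haar_space gate_transfer_orthonormal)
    also have "\<dots> = of_bool (q = q')" by (simp add: prob_space)
    finally have "of_bool (q = q') = (\<Sum>s\<in>UNIV. \<integral>u. gate_transfer2 s q q' u \<partial>\<mu>)" ..
    also have "\<dots> = (\<integral>u. gate_transfer2 ?I q q' u \<partial>\<mu>) + (\<Sum>s\<in>UNIV - {?I}. \<integral>u. gate_transfer2 s q q' u \<partial>\<mu>)"
      by (rule sum.remove) auto
    also have "(\<Sum>s\<in>UNIV - {?I}. \<integral>u. gate_transfer2 s q q' u \<partial>\<mu>) = 15 * (\<integral>u. gate_transfer2 p q q' u \<partial>\<mu>)"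
    proof -
      have "(\<Sum>s\<in>UNIV - {?I}. \<integral>u. gate_transfer2 s q q' u \<partial>\<mu>) =
          (\<Sum>s\<in>UNIV - {?I}. \<integral>u. gate_transfer2 p q q' u \<partial>\<mu>)"
        by (intro sum.cong refl same) simp
      then show ?thesis by (simp add: card_Diff_singleton)
    qed
    finally have "15 * (\<integral>u. gate_transfer2 p q q' u \<partial>\<mu>) = of_bool (q = q') - of_bool (q = ?I \<and> q' = ?I)"
      by (simp add: int_I)
    then show ?thesis using False by (auto simp: pauli_mixing_def field_simps)
  qed
qed

end

section \<open>Pauli strings and layers\<close>

type_synonym 'n pauli = "'n \<Rightarrow> bool \<times> bool"

definition pauli_string :: "'n::finite pauli \<Rightarrow> 'n operator" where
  "pauli_string P = (\<chi> x y. \<Prod>i\<in>UNIV. pauli_entry (P i) (x i) (y i))"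

text \<open>Left unnormalized, so that the identity coefficient of a state is 1; the factor
  \<open>2 ^ CARD('n)\<close> then appears in Parseval's identity.\<close>

definition pauli_coeff :: "'n::finite pauli \<Rightarrow> 'n operator \<Rightarrow> complex" where
  "pauli_coeff P \<rho> = trace (pauli_string P ** \<rho>)"

lemma pauli_string_hermitian: "cnj (pauli_string P $ x $ y) = pauli_string P $ y $ x"
  by (simp add: pauli_string_def pauli_entry_hermitian)

lemma prod_of_bool: "finite A \<Longrightarrow> (\<Prod>i\<in>A. of_bool (p i)) = (of_bool (\<forall>i\<in>A. p i) :: 'a::comm_semiring_1)"
  by (induction A rule: finite_induct) auto

text \<open>The sum over all strings of a product over sites factors into single-qubit sums, each
  evaluated by \<open>pauli_entry_complete\<close>.\<close>

lemma pauli_string_complete: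
  "(\<Sum>P\<in>UNIV. pauli_string P $ fst z $ snd z * cnj (pauli_string P $ fst z' $ snd z')) =
     2 ^ CARD('n) * of_bool (z = (z' :: 'n::finite bits \<times> 'n bits))"
proof -
  have "(\<Sum>P\<in>UNIV. pauli_string P $ fst z $ snd z * cnj (pauli_string P $ fst z' $ snd z')) =
    (\<Prod>i\<in>UNIV. \<Sum>p\<in>UNIV. pauli_entry p (fst z i) (snd z i) * cnj (pauli_entry p (fst z' i) (snd z' i)))"
    by (simp only: pauli_string_def vec_lambda_beta cnj_prod prod.distrib[symmetric]
        sum_fun_prod[symmetric])
  also have "\<dots> = 2 ^ CARD('n) * of_bool (\<forall>i. fst z i = fst z' i \<and> snd z i = snd z' i)"
    by (simp add: pauli_entry_complete prod.distrib prod_of_bool)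
  also have "(\<forall>i. fst z i = fst z' i \<and> snd z i = snd z' i) \<longleftrightarrow> z = z'"
    by (auto simp: prod_eq_iff fun_eq_iff)
  finally show ?thesis .
qed

lemma pauli_coeff_sum:
  "pauli_coeff P \<rho> = (\<Sum>z\<in>UNIV. pauli_string P $ fst z $ snd z * \<rho> $ snd z $ fst z)"
  by (simp add: pauli_coeff_def trace_mult_sum)

lemma pauli_string_id: "pauli_string (\<lambda>_. pauli_id) = mat 1"
  by (auto simp: pauli_string_def pauli_entry_def vec_eq_iff mat_def fun_eq_iff intro!: prod.neutral)

lemma trace_pauli_string: "trace (pauli_string P) = 2 ^ CARD('n) * of_bool (P = (\<lambda>_::'n::finite. pauli_id))"
proof -
  have "(\<Sum>x\<in>UNIV. pauli_entry p x x) = 2 * of_bool (p = pauli_id)" for p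
    by (cases p) (auto simp: pauli_entry_def UNIV_bool)
  then have "trace (pauli_string P) = (\<Prod>i\<in>UNIV. 2 * of_bool (P i = pauli_id))"
    by (simp add: trace_def pauli_string_def sum_fun_prod[where f="\<lambda>i y. pauli_entry (P i) y y"])
  then show ?thesis by (simp add: prod.distrib prod_of_bool fun_eq_iff)
qed

lemma pauli_coeff_id: "pauli_coeff (\<lambda>_. pauli_id) \<rho> = trace \<rho>"
  by (simp add: pauli_coeff_def pauli_string_id)

section \<open>Perfect pairings and tensor products over pairs\<close>

lemma pairing_ne: "perfect_pairing E \<Longrightarrow> e \<in> E \<Longrightarrow> fst e \<noteq> snd e"
  by (auto simp: perfect_pairing_def)

lemma pairing_unique:
  "perfect_pairing E \<Longrightarrow> e \<in> E \<Longrightarrow> e' \<in> E \<Longrightarrow> k \<in> {fst e, snd e} \<Longrightarrow> k \<in> {fst e', snd e'} \<Longrightarrow> e = e'"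
  unfolding perfect_pairing_def by blast

lemma pairing_cover: "perfect_pairing E \<Longrightarrow> \<exists>e\<in>E. k \<in> {fst e, snd e}"
  unfolding perfect_pairing_def by blast

lemma prod_pairing:
  fixes h :: "'n::finite \<Rightarrow> 'a::comm_monoid_mult"
  assumes "perfect_pairing E"
  shows "(\<Prod>i\<in>UNIV. h i) = (\<Prod>e\<in>E. h (fst e) * h (snd e))"
proof -
  have "UNIV = (\<Union>e\<in>E. {fst e, snd e})"
    using pairing_cover[OF assms] by blast
  then have "(\<Prod>i\<in>UNIV. h i) = (\<Prod>i\<in>(\<Union>e\<in>E. {fst e, snd e}). h i)" by simp
  also have "\<dots> = (\<Prod>e\<in>E. \<Prod>i\<in>{fst e, snd e}. h i)"
    by (rule prod.UNION_disjoint) (auto dest: pairing_unique[OF assms])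
  also have "\<dots> = (\<Prod>e\<in>E. h (fst e) * h (snd e))"
    by (rule prod.cong) (auto dest: pairing_ne[OF assms])
  finally show ?thesis .
qed

text \<open>Since the pairs partition the sites, a value for each site amounts to an independent
  choice of two values for each pair.\<close>

lemma sum_pairing:
  fixes F :: "'n::finite \<times> 'n \<Rightarrow> 'b::finite \<times> 'b \<Rightarrow> 'a::comm_semiring_1"
  assumes E: "perfect_pairing E"
  shows "(\<Sum>g\<in>UNIV. \<Prod>e\<in>E. F e (g (fst e), g (snd e))) = (\<Prod>e\<in>E. \<Sum>z\<in>UNIV. F e z)"
proof -
  define \<Phi> :: "('n \<Rightarrow> 'b) \<Rightarrow> 'n \<times> 'n \<Rightarrow> 'b \<times> 'b" where
    "\<Phi> = (\<lambda>g. \<lambda>e\<in>E. (g (fst e), g (snd e)))"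
  have "bij_betw \<Phi> UNIV (PiE E (\<lambda>_. UNIV))"
  proof (rule bij_betwI')
    fix g g' :: "'n \<Rightarrow> 'b"
    show "(\<Phi> g = \<Phi> g') = (g = g')"
    proof
      assume eq: "\<Phi> g = \<Phi> g'"
      show "g = g'"
      proof
        fix k
        obtain e where "e \<in> E" "k \<in> {fst e, snd e}" using pairing_cover[OF E] by blast
        then show "g k = g' k" using fun_cong[OF eq, of e] by (auto simp: \<Phi>_def)
      qed
    qed simp
  next
    fix h :: "'n \<times> 'n \<Rightarrow> 'b \<times> 'b"
    assume h: "h \<in> PiE E (\<lambda>_. UNIV)"
    \<comment> \<open>For surjectivity: \<open>pr k\<close> is the unique pair containing site
      \<open>k\<close>, and \<open>g\<close> below reads the component of \<open>h (pr k)\<close>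
      that belongs to \<open>k\<close>.\<close>
    define pr where "pr = (\<lambda>k. SOME e. e \<in> E \<and> k \<in> {fst e, snd e})"
    have "pr k \<in> E \<and> k \<in> {fst (pr k), snd (pr k)}" for k
      unfolding pr_def by (rule someI_ex) (use pairing_cover[OF E] in blast)
    then have pr: "pr (fst e) = e" "pr (snd e) = e" if "e \<in> E" for e
      using pairing_unique[OF E _ that] by blast+
    define g where "g = (\<lambda>k. if k = fst (pr k) then fst (h (pr k)) else snd (h (pr k)))"
    have gh: "(g (fst e), g (snd e)) = h e" if "e \<in> E" for e
      using pr[OF that] pairing_ne[OF E that] by (simp add: g_def)
    have "h = \<Phi> g"
    proof
      fix e
      show "h e = \<Phi> g e"
        using h gh[of e] by (cases "e \<in> E") (auto simp: \<Phi>_def)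
    qed
    then show "\<exists>g\<in>UNIV. h = \<Phi> g" by blast
  qed (auto simp: \<Phi>_def)
  then have "(\<Sum>h\<in>PiE E (\<lambda>_. UNIV). \<Prod>e\<in>E. F e (h e)) = (\<Sum>g\<in>UNIV. \<Prod>e\<in>E. F e (\<Phi> g e))"
    by (rule sum.reindex_bij_betw[symmetric])
  then show ?thesis
    by (simp add: prod_sum_PiE \<Phi>_def)
qed

lemma layer_unitary_nth:
  "layer_unitary E f $ x $ y = (\<Prod>e\<in>E. f e $ (x (fst e), x (snd e)) $ (y (fst e), y (snd e)))"
  by (simp add: layer_unitary_def case_prod_beta)

lemma layer_unitary_cong: "(\<And>e. e \<in> E \<Longrightarrow> f e = g e) \<Longrightarrow> layer_unitary E f = layer_unitary E g"
  by (simp add: vec_eq_iff layer_unitary_nth)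

lemma layer_unitary_mult:
  assumes "perfect_pairing E"
  shows "layer_unitary E f ** layer_unitary E g = layer_unitary E (\<lambda>e. f e ** g e)"
  by (simp add: vec_eq_iff matrix_matrix_mult_def layer_unitary_nth prod.distrib[symmetric] sum_pairing[OF assms,
        of "\<lambda>e z. f e $ (x (fst e), x (snd e)) $ z * g e $ z $ (y (fst e), y (snd e))" for x y])

lemma dagger_layer_unitary: "dagger (layer_unitary E f) = layer_unitary E (\<lambda>e. dagger (f e))"
  by (simp add: vec_eq_iff dagger_def layer_unitary_nth)

lemma trace_layer_unitary:
  assumes "perfect_pairing E"
  shows "trace (layer_unitary E f) = (\<Prod>e\<in>E. trace (f e))"
  by (simp add: trace_def layer_unitary_nth sum_pairing[OF assms, of "\<lambda>e z. f e $ z $ z"])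

text \<open>Writing strings as tensor products over the same pairs as the gates lets products and
  traces of both be computed pair by pair.\<close>

lemma pauli_string_pairing:
  assumes "perfect_pairing E"
  shows "pauli_string P = layer_unitary E (\<lambda>e. pauli_pair (P (fst e), P (snd e)))"
  by (simp add: vec_eq_iff layer_unitary_nth pauli_string_def pauli_pair_def prod_pairing[OF assms])

lemma layer_unitary_one:
  assumes "perfect_pairing E"
  shows "layer_unitary E (\<lambda>_. mat 1) = mat 1"
  using pauli_string_pairing[OF assms, of "\<lambda>_. pauli_id"] by (simp add: pauli_string_id pauli_pair_id)

lemma layer_unitary_in_unitary_group:
  assumes "perfect_pairing E" "\<And>e. e \<in> E \<Longrightarrow> f e \<in> unitary_group"
  shows "layer_unitary E f \<in> unitary_group"
proof -
  have "layer_unitary E (\<lambda>e. dagger (f e) ** f e) = layer_unitary E (\<lambda>_. mat 1)"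
    "layer_unitary E (\<lambda>e. f e ** dagger (f e)) = layer_unitary E (\<lambda>_. mat 1)"
    by (rule layer_unitary_cong, use assms(2) in \<open>simp add: unitary_group_def\<close>)+
  then show ?thesis
    by (simp add: unitary_group_def dagger_layer_unitary layer_unitary_mult layer_unitary_one assms(1))
qed

text \<open>Heisenberg picture: the layer is moved onto the string, giving \<open>M\<close>, and
  \<rho> is expanded in strings. The coefficients of \<open>M\<close> factor over the pairs because
  the layer and all strings do.\<close>

lemma pauli_coeff_layer:
  fixes \<rho> :: "'n::finite operator"
  assumes E: "perfect_pairing E"
  shows "pauli_coeff P (unitary_channel (layer_unitary E g) \<rho>) =
    (\<Sum>Q\<in>UNIV. (\<Prod>e\<in>E. gate_transfer (g e) (P (fst e), P (snd e)) (Q (fst e), Q (snd e))) * pauli_coeff Q \<rho>)"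
proof -
  define U where "U = layer_unitary E g"
  define M where "M = dagger U ** pauli_string P ** U"
  have MA: "trace (M ** A) = trace (pauli_string P ** (U ** A ** dagger U))" for A
    using trace_mul_sym[of "dagger U" "pauli_string P ** U ** A"] by (simp add: M_def matrix_mul_assoc)
  have tr: "trace (M ** pauli_string Q) = 2 ^ CARD('n) *
    (\<Prod>e\<in>E. gate_transfer (g e) (P (fst e), P (snd e)) (Q (fst e), Q (snd e)))" (is "_ = _ * ?R Q") for Q
  proof -
    have "trace (M ** pauli_string Q) = (\<Prod>e\<in>E. 4 * gate_transfer (g e) (P (fst e), P (snd e)) (Q (fst e), Q (snd e)))"
      by (simp add: MA U_def pauli_string_pairing[OF E] layer_unitary_mult[OF E] dagger_layer_unitary
          trace_layer_unitary[OF E] gate_transfer_def)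
    also have "\<dots> = (\<Prod>e\<in>E. 4) * ?R Q" by (rule prod.distrib)
    \<comment> \<open>Each pair has two sites, so a factor 4 per pair is a factor 2 per
      site.\<close>
    also have "(\<Prod>e\<in>E. 4) = (\<Prod>i\<in>(UNIV::'n set). (2::complex))"
      by (simp add: prod_pairing[OF E] del: prod_constant)
    finally show ?thesis by simp
  qed
  have "2 ^ CARD('n) * trace (M ** \<rho>) = (\<Sum>z\<in>UNIV. M $ fst z $ snd z * (2 ^ CARD('n) * \<rho> $ snd z $ fst z))"
    by (simp add: trace_mult_sum sum_distrib_left mult_ac)
  also have "\<dots> = (\<Sum>z\<in>UNIV. M $ fst z $ snd z *
      (\<Sum>Q\<in>UNIV. cnj (pauli_string Q $ fst z $ snd z) * pauli_coeff Q \<rho>))"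
    by (simp only: pauli_coeff_sum complete_system_expansion[OF pauli_string_complete, of _ "\<lambda>z. \<rho> $ snd z $ fst z"])
  also have "\<dots> = (\<Sum>z\<in>UNIV. \<Sum>Q\<in>UNIV. M $ fst z $ snd z * pauli_string Q $ snd z $ fst z * pauli_coeff Q \<rho>)"
    by (simp add: pauli_string_hermitian sum_distrib_left mult_ac)
  also have "\<dots> = (\<Sum>Q\<in>UNIV. \<Sum>z\<in>UNIV. M $ fst z $ snd z * pauli_string Q $ snd z $ fst z * pauli_coeff Q \<rho>)"
    by (rule sum.swap)
  also have "\<dots> = (\<Sum>Q\<in>UNIV. trace (M ** pauli_string Q) * pauli_coeff Q \<rho>)"
    by (simp add: trace_mult_sum sum_distrib_right)
  also have "\<dots> = 2 ^ CARD('n) * (\<Sum>Q\<in>UNIV. ?R Q * pauli_coeff Q \<rho>)"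
    by (simp only: tr sum_distrib_left mult.assoc)
  finally show ?thesis
    by (simp add: MA pauli_coeff_def[of P] unitary_channel_def U_def)
qed

section \<open>Dephasing and the initial state in the Pauli basis\<close>

lemma dephase_sites_insert:
  "i \<notin> S \<Longrightarrow> dephase_sites q (insert i S) \<rho> = dephase q i (dephase_sites q S \<rho>)"
proof -
  assume "i \<notin> S"
  interpret comp_fun_commute "dephase q" by (rule comp_fun_commute_dephase)
  show ?thesis using \<open>i \<notin> S\<close> by (simp add: dephase_sites_def)
qed

lemma dephase_sites_empty: "dephase_sites q {} \<rho> = \<rho>"
  by (simp add: dephase_sites_def)

text \<open>Conjugation by \<open>pauli_Z i\<close> flips the sign of an entry exactly when its two
  indices differ at \<open>i\<close>, which leaves the factor \<open>(1 - q) - q\<close>.\<close>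

lemma dephase_sites_nth:
  "dephase_sites q S \<rho> $ x $ y = (\<Prod>i\<in>S. if x i = y i then 1 else 1 - 2 * of_real q) * \<rho> $ x $ y"
proof (induction S rule: finite_induct[OF finite])
  case (2 i S)
  then show ?case
    unfolding dephase_sites_insert[OF 2(2)] dephase_def vector_add_component vector_scaleR_component pauli_Z_conj_nth
    by (auto simp: scaleR_conv_of_real algebra_simps)
qed (simp add: dephase_sites_empty)

text \<open>In the encoding, \<open>fst (P i)\<close> marks X and Y, the two Pauli matrices that
  anticommute with Z.\<close>

definition dephasing_factor :: "real \<Rightarrow> 'n set \<Rightarrow> 'n pauli \<Rightarrow> real" where
  "dephasing_factor q S P = (\<Prod>i\<in>S. if fst (P i) then 1 - 2 * q else 1)"

lemma pauli_string_nonzero: "pauli_string P $ x $ y \<noteq> 0 \<Longrightarrow> (x i = y i) \<longleftrightarrow> \<not> fst (P i)"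
  by (auto simp: pauli_string_def pauli_entry_def split: if_splits)

text \<open>Where the string has a nonzero entry, the two indices differ exactly at its X and Y
  sites. The entrywise factor is therefore constant on the support of the string.\<close>

lemma pauli_coeff_dephase_sites:
  "pauli_coeff P (dephase_sites q S \<rho>) = of_real (dephasing_factor q S P) * pauli_coeff P \<rho>"
proof -
  have "pauli_string P $ fst z $ snd z * dephase_sites q S \<rho> $ snd z $ fst z =
    of_real (dephasing_factor q S P) * (pauli_string P $ fst z $ snd z * \<rho> $ snd z $ fst z)" for z
  proof (cases "pauli_string P $ fst z $ snd z = 0")
    case False
    then have "(snd z i = fst z i) \<longleftrightarrow> \<not> fst (P i)" for i
      using pauli_string_nonzero[of P "fst z" "snd z" i] by auto
    then have "(\<Prod>i\<in>S. if snd z i = fst z i then 1 else 1 - 2 * of_real q) = (of_real (dephasing_factor q S P) :: complex)"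
      by (auto simp: dephasing_factor_def intro!: prod.cong)
    then show ?thesis by (simp add: dephase_sites_nth)
  qed simp
  then show ?thesis unfolding pauli_coeff_sum sum_distrib_left by (intro sum.cong refl)
qed

lemma pauli_coeff_zero_state: "pauli_coeff P zero_state = of_bool (\<forall>i. \<not> fst (P i))"
proof -
  have "pauli_coeff P zero_state = (\<Sum>z\<in>UNIV. if z = ((\<lambda>_. False), (\<lambda>_. False)) then
     pauli_string P $ fst z $ snd z else 0)"
    unfolding pauli_coeff_sum by (rule sum.cong) (auto simp: zero_state_def prod_eq_iff)
  also have "\<dots> = pauli_string P $ (\<lambda>_. False) $ (\<lambda>_. False)" by simp
  also have "\<dots> = (\<Prod>i\<in>UNIV. of_bool (\<not> fst (P i)))"
    unfolding pauli_string_def vec_lambda_beta by (rule prod.cong) (auto simp: pauli_entry_def)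
  finally show ?thesis by (simp add: prod_of_bool)
qed

section \<open>Positivity and trace, for the output to be a probability distribution\<close>

definition pos_semidef :: "'n::finite operator \<Rightarrow> bool" where
  "pos_semidef \<rho> \<longleftrightarrow> (\<forall>v. 0 \<le> Re (trace (\<rho> ** (\<chi> x y. v x * cnj (v y)))))"

lemma pos_semidef_conj:
  assumes "pos_semidef \<rho>"
  shows "pos_semidef (A ** \<rho> ** dagger A)"
  unfolding pos_semidef_def
proof
  fix v
  \<comment> \<open>\<open>w\<close> is \<open>dagger A\<close> applied to \<open>v\<close>: the
    test vector is pulled back through the conjugation.\<close>
  define w where "w = (\<lambda>b. \<Sum>y\<in>UNIV. cnj (A $ y $ b) * v y)"
  have "dagger A ** (\<chi> x y. v x * cnj (v y)) ** A = (\<chi> x y. w x * cnj (w y))"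
    by (simp add: vec_eq_iff matrix_matrix_mult_def dagger_def w_def sum_product sum_distrib_left sum_distrib_right mult_ac)
  then have "trace (A ** \<rho> ** dagger A ** (\<chi> x y. v x * cnj (v y))) = trace (\<rho> ** (\<chi> x y. w x * cnj (w y)))"
    using trace_mul_sym[of A "\<rho> ** dagger A ** (\<chi> x y. v x * cnj (v y))"]
    by (simp add: matrix_mul_assoc flip: \<open>dagger A ** _ ** A = _\<close>)
  then show "0 \<le> Re (trace (A ** \<rho> ** dagger A ** (\<chi> x y. v x * cnj (v y))))"
    using assms by (simp add: pos_semidef_def)
qed

lemma pos_semidef_dephase:
  assumes "pos_semidef \<rho>" "0 \<le> q" "q \<le> 1"
  shows "pos_semidef (dephase q i \<rho>)"
proof -
  have "dagger (pauli_Z i) = pauli_Z i"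
    by (auto simp: dagger_def pauli_Z_def vec_eq_iff)
  then have Z: "pos_semidef (pauli_Z i ** \<rho> ** pauli_Z i)"
    using pos_semidef_conj[OF assms(1), of "pauli_Z i"] by simp
  have "trace (c *\<^sub>R B) = of_real c * trace B" for c and B :: "'a operator"
    by (simp add: trace_def sum_distrib_left scaleR_conv_of_real[symmetric] scaleR_sum_right)
  then have "trace (dephase q i \<rho> ** V) =
      of_real (1 - q) * trace (\<rho> ** V) + of_real q * trace (pauli_Z i ** \<rho> ** pauli_Z i ** V)" for V
    by (simp only: dephase_def matrix_add_rdistrib scalar_matrix_assoc[symmetric] trace_add)
  then show ?thesis
    using assms Z by (simp add: pos_semidef_def)
qed

lemma pos_semidef_dephase_sites:
  assumes "pos_semidef \<rho>" "0 \<le> q" "q \<le> 1"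
  shows "pos_semidef (dephase_sites q S \<rho>)"
  by (induction S rule: finite_induct[OF finite])
     (simp_all add: dephase_sites_empty dephase_sites_insert pos_semidef_dephase assms)

lemma pos_semidef_diag:
  assumes "pos_semidef \<rho>"
  shows "0 \<le> Re (\<rho> $ x $ x)"
proof -
  define v :: "'a bits \<Rightarrow> complex" where "v = (\<lambda>y. if y = x then 1 else 0)"
  have "(\<rho> ** (\<chi> a b. v a * cnj (v b))) $ y $ y = (if y = x then \<rho> $ x $ x else 0)" for y
  proof -
    have "(\<rho> ** (\<chi> a b. v a * cnj (v b))) $ y $ y =
      (\<Sum>k\<in>UNIV. if k = x then (if y = x then \<rho> $ x $ x else 0) else 0)"
      unfolding matrix_matrix_mult_def v_def vec_lambda_beta by (rule sum.cong) auto
    then show ?thesis by simp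
  qed
  then have "trace (\<rho> ** (\<chi> a b. v a * cnj (v b))) = \<rho> $ x $ x"
    by (simp add: trace_def)
  then show ?thesis using assms[unfolded pos_semidef_def, rule_format, of v] by simp
qed

lemma pos_semidef_zero_state: "pos_semidef (zero_state :: 'n::finite operator)"
  unfolding pos_semidef_def
proof
  fix v :: "'n bits \<Rightarrow> complex"
  let ?o = "\<lambda>_::'n. False"
  have "(zero_state ** (\<chi> x y. v x * cnj (v y))) $ x $ x = (if x = ?o then v ?o * cnj (v ?o) else 0)" for x
  proof -
    have "(zero_state ** (\<chi> x y. v x * cnj (v y))) $ x $ x =
      (\<Sum>k\<in>UNIV. if k = ?o then (if x = ?o then v ?o * cnj (v ?o) else 0) else 0)"
      unfolding matrix_matrix_mult_def zero_state_def vec_lambda_beta by (rule sum.cong) auto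
    then show ?thesis by simp
  qed
  then have "trace (zero_state ** (\<chi> x y. v x * cnj (v y))) = of_real ((norm (v ?o))\<^sup>2)"
    by (simp only: trace_def complex_norm_square) simp
  then show "0 \<le> Re (trace (zero_state ** (\<chi> x y. v x * cnj (v y))))" by simp
qed

lemma trace_dephase_sites: "trace (dephase_sites q S \<rho>) = trace \<rho>"
  by (simp add: trace_def dephase_sites_nth)

lemma trace_zero_state: "trace zero_state = 1"
  by (simp add: trace_def zero_state_def)

section \<open>Total variation distance\<close>

text \<open>The differences sum to 0, so a set and its complement deviate equally, and each accounts
  for at most half of the total.\<close>

lemma tv_dist_le_half_sum:
  fixes D E :: "'a::finite \<Rightarrow> real"
  assumes "(\<Sum>x\<in>UNIV. D x) = (\<Sum>x\<in>UNIV. E x)"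
  shows "tv_dist D E \<le> (\<Sum>x\<in>UNIV. \<bar>D x - E x\<bar>) / 2"
  unfolding tv_dist_def
proof (rule Max.boundedI)
  fix t assume "t \<in> range (\<lambda>S. \<bar>(\<Sum>x\<in>S. D x) - (\<Sum>x\<in>S. E x)\<bar>)"
  then obtain S where t: "t = \<bar>(\<Sum>x\<in>S. D x) - (\<Sum>x\<in>S. E x)\<bar>" by blast
  define g where "g = (\<lambda>x. D x - E x)"
  have split: "(\<Sum>x\<in>UNIV. h x) = (\<Sum>x\<in>S. h x) + (\<Sum>x\<in>-S. h x)" for h :: "'a \<Rightarrow> real"
    by (rule sum.subset_diff[of S UNIV, simplified, folded Compl_eq_Diff_UNIV, THEN trans]) simp
  have "(\<Sum>x\<in>UNIV. g x) = 0" using assms by (simp add: g_def sum_subtractf)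
  then have "\<bar>\<Sum>x\<in>S. g x\<bar> = \<bar>\<Sum>x\<in>-S. g x\<bar>" using split[of g] by simp
  moreover have "\<bar>\<Sum>x\<in>S. g x\<bar> \<le> (\<Sum>x\<in>S. \<bar>g x\<bar>)" "\<bar>\<Sum>x\<in>-S. g x\<bar> \<le> (\<Sum>x\<in>-S. \<bar>g x\<bar>)"
    by (rule sum_abs)+
  moreover have "t = \<bar>\<Sum>x\<in>S. g x\<bar>" by (simp add: t g_def sum_subtractf)
  ultimately have "t \<le> (\<Sum>x\<in>UNIV. \<bar>g x\<bar>) / 2"
    using split[of "\<lambda>x. \<bar>g x\<bar>"] by linarith
  then show "t \<le> (\<Sum>x\<in>UNIV. \<bar>D x - E x\<bar>) / 2" by (simp add: g_def)
qed auto

lemma tv_dist_nonneg: "0 \<le> tv_dist D E"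
  unfolding tv_dist_def by (rule order.trans[OF abs_ge_zero Max_ge]) auto

lemma tv_dist_le_1:
  fixes D E :: "'a::finite \<Rightarrow> real"
  assumes "\<And>x. 0 \<le> D x" "\<And>x. 0 \<le> E x" "(\<Sum>x\<in>UNIV. D x) = 1" "(\<Sum>x\<in>UNIV. E x) = 1"
  shows "tv_dist D E \<le> 1"
proof -
  have "0 \<le> (\<Sum>x\<in>S. h x) \<and> (\<Sum>x\<in>S. h x) \<le> 1"
    if "\<And>x. 0 \<le> h x" "(\<Sum>x\<in>UNIV. h x) = 1" for h :: "'a \<Rightarrow> real" and S
    using sum_mono2[of UNIV S h] that by (auto simp: sum_nonneg)
  from this[OF assms(1,3)] this[OF assms(2,4)] show ?thesis
    unfolding tv_dist_def by (subst Max_le_iff) (auto simp: abs_le_iff intro: order_trans, smt+)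
qed

lemma sum_uniform_dist: "(\<Sum>x\<in>UNIV. uniform_dist (x :: 'n::finite bits)) = 1"
  by (simp add: uniform_dist_def card_fun)

text \<open>Cauchy-Schwarz over the \<open>2 ^ CARD('n)\<close> outcomes passes to the squared
  deviations on the diagonal. Adding the off-diagonal entries gives the squared Hilbert-Schmidt
  distance from the maximally mixed state, which Parseval's identity turns into Pauli coefficients.
  The subtracted 1 is the identity coefficient.\<close>

lemma tv_dist_uniform_le_pauli:
  fixes \<rho> :: "'n::finite operator"
  assumes "trace \<rho> = 1"
  shows "(2 * tv_dist (\<lambda>x. Re (\<rho> $ x $ x)) uniform_dist)\<^sup>2 \<le> (\<Sum>P\<in>UNIV. (cmod (pauli_coeff P \<rho>))\<^sup>2) - 1"
proof -
  let ?N = "2 ^ CARD('n) :: real"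
  \<comment> \<open>The deviation from the maximally mixed state, with positions transposed to match
    \<open>pauli_coeff_sum\<close>. Subtracting that state removes the identity coefficient and
    changes no other.\<close>
  define \<sigma> where "\<sigma> = (\<lambda>z::'n bits \<times> 'n bits. \<rho> $ snd z $ fst z - of_bool (snd z = fst z) / 2 ^ CARD('n))"
  define s where "s = (\<lambda>P. \<Sum>z\<in>UNIV. pauli_string P $ fst z $ snd z * \<sigma> z)"
  have s: "s P = (if P = (\<lambda>_. pauli_id) then 0 else pauli_coeff P \<rho>)" for P
  proof -
    have "s P = pauli_coeff P \<rho> - pauli_coeff P (mat 1) / 2 ^ CARD('n)"
      unfolding s_def \<sigma>_def pauli_coeff_sum mat_def vec_lambda_beta sum_divide_distrib sum_subtractf[symmetric]
      by (rule sum.cong) (auto simp: algebra_simps)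
    also have "pauli_coeff P (mat 1) / 2 ^ CARD('n) = of_bool (P = (\<lambda>_. pauli_id))"
      by (simp add: pauli_coeff_def trace_pauli_string)
    finally show ?thesis using assms by (auto simp: pauli_coeff_id)
  qed
  have "(\<Sum>P\<in>UNIV. s P * cnj (s P)) = 2 ^ CARD('n) * (\<Sum>z\<in>UNIV. \<sigma> z * cnj (\<sigma> z))"
    unfolding s_def by (rule complete_system_parseval[OF pauli_string_complete])
  then have "of_real (\<Sum>P\<in>UNIV. (cmod (s P))\<^sup>2) = (of_real (?N * (\<Sum>z\<in>UNIV. (cmod (\<sigma> z))\<^sup>2)) :: complex)"
    by (simp only: of_real_sum of_real_mult complex_norm_square) simp
  then have parseval: "(\<Sum>P\<in>UNIV. (cmod (s P))\<^sup>2) = ?N * (\<Sum>z\<in>UNIV. (cmod (\<sigma> z))\<^sup>2)"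
    by (simp only: of_real_eq_iff)
  have "(\<Sum>P\<in>UNIV. (cmod (pauli_coeff P \<rho>))\<^sup>2) =
      (cmod (pauli_coeff (\<lambda>_. pauli_id) \<rho>))\<^sup>2 + (\<Sum>P\<in>UNIV - {\<lambda>_. pauli_id}. (cmod (pauli_coeff P \<rho>))\<^sup>2)"
    by (rule sum.remove) auto
  also have "(\<Sum>P\<in>UNIV - {\<lambda>_. pauli_id}. (cmod (pauli_coeff P \<rho>))\<^sup>2) = (\<Sum>P\<in>UNIV. (cmod (s P))\<^sup>2)"
    by (rule sum.mono_neutral_cong_left) (auto simp: s)
  finally have chi: "(\<Sum>P\<in>UNIV. (cmod (pauli_coeff P \<rho>))\<^sup>2) - 1 = ?N * (\<Sum>z\<in>UNIV. (cmod (\<sigma> z))\<^sup>2)"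
    by (simp add: pauli_coeff_id assms parseval)
  define g where "g = (\<lambda>x. Re (\<rho> $ x $ x) - uniform_dist x)"
  have "(\<Sum>x\<in>UNIV. Re (\<rho> $ x $ x)) = 1"
    using assms by (simp add: trace_def flip: Re_sum)
  then have "2 * tv_dist (\<lambda>x. Re (\<rho> $ x $ x)) uniform_dist \<le> (\<Sum>x\<in>UNIV. \<bar>g x\<bar>)"
    using tv_dist_le_half_sum[of "\<lambda>x. Re (\<rho> $ x $ x)" uniform_dist]
    by (simp add: sum_uniform_dist g_def)
  then have "(2 * tv_dist (\<lambda>x. Re (\<rho> $ x $ x)) uniform_dist)\<^sup>2 \<le> (\<Sum>x\<in>UNIV. 1 * \<bar>g x\<bar>)\<^sup>2"
    by (intro power_mono) (simp_all add: tv_dist_nonneg)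
  also have "\<dots> \<le> (\<Sum>x\<in>(UNIV :: 'n bits set). 1\<^sup>2) * (\<Sum>x\<in>UNIV. \<bar>g x\<bar>\<^sup>2)"
    by (rule Cauchy_Schwarz_ineq_sum)
  also have "\<dots> = ?N * (\<Sum>x\<in>UNIV. (g x)\<^sup>2)"
    by (simp add: card_fun)
  also have "(\<Sum>x\<in>UNIV. (g x)\<^sup>2) \<le> (\<Sum>x\<in>UNIV. (cmod (\<sigma> (x, x)))\<^sup>2)"
  proof (rule sum_mono)
    fix x
    have "g x = Re (\<sigma> (x, x))"
      by (simp add: g_def \<sigma>_def uniform_dist_def Re_divide_of_real[of _ "2 ^ CARD('n)", simplified])
    then show "(g x)\<^sup>2 \<le> (cmod (\<sigma> (x, x)))\<^sup>2"
      by (metis abs_Re_le_cmod abs_le_square_iff abs_norm_cancel)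
  qed
  also have "(\<Sum>x\<in>UNIV. (cmod (\<sigma> (x, x)))\<^sup>2) \<le> (\<Sum>z\<in>UNIV. (cmod (\<sigma> z))\<^sup>2)"
    unfolding sum_UNIV_pair by (intro sum_mono member_le_sum) auto
  finally show ?thesis by (simp add: chi)
qed

section \<open>Decay of the Pauli weights\<close>

text \<open>The recursion satisfied by the expected squared moduli of the coefficients, see
  \<open>integral_norm_coeff\<close>; \<open>f\<close> is the mean of the squared dephasing factor
  of an X or Y at one site.\<close>

primrec pauli_weight :: "real \<Rightarrow> (nat \<Rightarrow> ('n::finite \<times> 'n) set) \<Rightarrow> nat \<Rightarrow> 'n pauli \<Rightarrow> real" where
  "pauli_weight f E 0 P = of_bool (\<forall>i. \<not> fst (P i))"
| "pauli_weight f E (Suc m) P = (\<Prod>i\<in>UNIV. if fst (P i) then f else 1) *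
     (\<Sum>Q\<in>UNIV. (\<Prod>e\<in>E m. pauli_mixing (P (fst e), P (snd e)) (Q (fst e), Q (snd e))) * pauli_weight f E m Q)"

text \<open>The weight that survives on the marked sites of a pair, as a fraction of the weight of the
  non-identity Pauli operators on that pair before the gate.\<close>

definition pair_survival :: "real \<Rightarrow> bool \<Rightarrow> bool \<Rightarrow> real" where
  "pair_survival f a b = (if a \<and> b then (4 * (1 + f)\<^sup>2 - 1) / 15 else if a \<or> b then (1 + 2 * f) / 15 else 0)"

text \<open>On a marked site I and Z count 1 and X and Y count \<open>f\<close>, in total
  \<open>2 + 2 * f\<close>; an unmarked site admits only I. An identity input yields 1. Any other
  input spreads evenly over the 15 non-identity outputs, so the product of the site totals, less 1
  for the identity output, is divided by 15.\<close>

lemma sum_pauli_mixing: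
  "(\<Sum>p\<in>UNIV. (of_bool (a \<or> fst p = pauli_id) * (if fst (fst p) then f else 1)) *
      (of_bool (b \<or> snd p = pauli_id) * (if fst (snd p) then f else 1)) * pauli_mixing p q) =
   (1 - pair_survival f a b) * of_bool (q = (pauli_id, pauli_id)) + pair_survival f a b"
  by (cases "q = (pauli_id, pauli_id)"; cases a; cases b)
     (simp_all add: sum_UNIV_pair UNIV_bool pauli_mixing_def pair_survival_def field_simps power2_eq_square)

lemma pair_survival_bounds:
  assumes "0 \<le> f" "f \<le> 1"
  shows "0 \<le> pair_survival f a b" "pair_survival f a b \<le> 1"
proof -
  define s where "s = (1 + f)\<^sup>2"
  have "1 \<le> s" "s \<le> 2\<^sup>2"
    using assms by (simp add: s_def, unfold s_def, intro power_mono) auto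
  then show "0 \<le> pair_survival f a b" "pair_survival f a b \<le> 1"
    using assms by (auto simp: pair_survival_def simp flip: s_def)
qed

text \<open>The induction step of the decay estimate, reduced to one pair: a surviving pair
  contributes \<open>(1 + \<epsilon>)\<^sup>2\<close>, a pair forced to be the identity contributes
  1. Here \<kappa> equals \<open>(1 + 2 * f) / 3\<close>, the mean damping of a uniformly random
  non-identity Pauli matrix on one site.\<close>

lemma pair_survival_contraction:
  fixes f \<epsilon> :: real
  assumes "0 \<le> f" "f \<le> 1" "0 \<le> \<epsilon>" "\<epsilon> \<le> 1"
  defines "\<kappa> \<equiv> 1 - 2 * (1 - f) / 3"
  shows "pair_survival f a b * (1 + \<epsilon>)\<^sup>2 + (1 - pair_survival f a b) \<le>
    (if a then 1 + \<kappa> * \<epsilon> else 1) * (if b then 1 + \<kappa> * \<epsilon> else 1)"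
proof -
  define h where "h = 1 - f"
  have h: "0 \<le> h" "h \<le> 1" "f = 1 - h" "\<kappa> = 1 - 2 * h / 3" using assms by (auto simp: h_def)
  have hh: "h * h \<le> h" using h by (simp add: mult_left_le)
  have ee: "\<epsilon> * \<epsilon> \<le> \<epsilon>" using assms by (simp add: mult_left_le)
  \<comment> \<open>One marked site: bounding the square of \<epsilon> by \<epsilon> leaves
    \<open>(1 + 2 * f) / 5\<close>, which is below \<kappa>.\<close>
  have one: "(1 + 2 * f) / 15 * (2 * \<epsilon> + \<epsilon> * \<epsilon>) \<le> \<kappa> * \<epsilon>"
  proof -
    have "(1 + 2 * f) / 15 * (2 * \<epsilon> + \<epsilon> * \<epsilon>) \<le> (1 + 2 * f) / 15 * (3 * \<epsilon>)"
      using ee assms by (intro mult_left_mono) auto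
    also have "\<dots> = ((1 + 2 * f) / 5) * \<epsilon>" by simp
    also have "\<dots> \<le> \<kappa> * \<epsilon>"
      using h assms(3) by (intro mult_right_mono) (auto simp: field_simps)
    finally show ?thesis .
  qed
  have two: "(4 * (1 + f)\<^sup>2 - 1) / 15 * (2 * \<epsilon> + \<epsilon> * \<epsilon>) \<le> 2 * \<kappa> * \<epsilon> + \<kappa> * \<kappa> * \<epsilon> * \<epsilon>"
  proof -
    define c where "c = (4 * (1 + f)\<^sup>2 - 1) / 15"
    have c: "c = 1 - 16 * h / 15 + 4 * (h * h) / 15"
      by (simp add: c_def h power2_eq_square field_simps)
    \<comment> \<open>After division by \<epsilon> the claim is affine in \<epsilon>, so it follows
      from its endpoints 0 and 1, which are these two inequalities (the first up to a factor
      2).\<close>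
    have "0 \<le> \<kappa> - c" "0 \<le> 2 * \<kappa> + \<kappa> * \<kappa> - 3 * c"
      unfolding c using h(1,2) hh by (simp_all add: h(4) field_simps)
    then have "0 \<le> \<epsilon> * ((1 - \<epsilon>) * (2 * (\<kappa> - c)) + \<epsilon> * (2 * \<kappa> + \<kappa> * \<kappa> - 3 * c))"
      using assms(3,4) by (intro mult_nonneg_nonneg add_nonneg_nonneg) auto
    also have "\<dots> = 2 * \<kappa> * \<epsilon> + \<kappa> * \<kappa> * \<epsilon> * \<epsilon> - c * (2 * \<epsilon> + \<epsilon> * \<epsilon>)"
      by (simp add: algebra_simps)
    finally show ?thesis by (simp add: c_def)
  qed
  have sq: "c * (1 + \<epsilon>)\<^sup>2 + (1 - c) = 1 + c * (2 * \<epsilon> + \<epsilon> * \<epsilon>)" for c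
    by (simp add: power2_eq_square algebra_simps)
  have sq': "(1 + \<kappa> * \<epsilon>) * (1 + \<kappa> * \<epsilon>) = 1 + (2 * \<kappa> * \<epsilon> + \<kappa> * \<kappa> * \<epsilon> * \<epsilon>)"
    by (simp add: algebra_simps)
  show ?thesis
    unfolding sq by (cases a; cases b) (simp_all only: pair_survival_def if_True if_False simp_thms
        mult_1_left mult_1_right mult_zero_left add_0_right order_refl add_le_cancel_left sq' one two)
qed

text \<open>General sets \<open>A\<close> make the induction close. Undoing a layer turns the weight
  inside \<open>A\<close> into an average of weights inside unions of pairs, in which each pair
  \<open>e\<close> is kept independently with probability \<open>c e\<close>. Only the sizes of
  these unions enter, so the pairings may change from layer to layer.\<close>

lemma pauli_weight_support_le:
  fixes E :: "nat \<Rightarrow> ('n::finite \<times> 'n) set"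
  assumes f: "0 \<le> f" "f \<le> 1" and E: "\<And>k. k < m \<Longrightarrow> perfect_pairing (E k)"
  shows "(\<Sum>P\<in>UNIV. of_bool (\<forall>i. i \<in> A \<or> P i = pauli_id) * pauli_weight f E m P) \<le>
    (1 + (1 - 2 * (1 - f) / 3) ^ m) ^ card A"
  using E
proof (induction m arbitrary: A)
  case 0
  have "(\<Sum>P\<in>UNIV. of_bool (\<forall>i. i \<in> A \<or> P i = pauli_id) * pauli_weight f E 0 P) =
    (\<Sum>P\<in>UNIV. \<Prod>i\<in>UNIV. of_bool (i \<in> A \<or> P i = pauli_id) * of_bool (\<not> fst (P i)))"
    by (simp only: prod.distrib prod_of_bool[OF finite] ball_UNIV pauli_weight.simps)
  also have "\<dots> = (\<Prod>i\<in>UNIV. \<Sum>p\<in>UNIV. of_bool (i \<in> A \<or> p = pauli_id) * of_bool (\<not> fst p))"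
    by (rule sum_fun_prod)
  \<comment> \<open>Initially I and Z both have weight 1 on a site of \<open>A\<close>; the 2 is
    \<open>1 + \<kappa> ^ 0\<close>.\<close>
  also have "\<dots> = (\<Prod>i\<in>UNIV. if i \<in> A then 2 else 1)"
    by (rule prod.cong) (auto simp: sum_UNIV_pair UNIV_bool)
  also have "\<dots> = 2 ^ card A" by (simp add: prod.If_cases)
  finally show ?case by simp
next
  case (Suc m)
  define \<kappa> where "\<kappa> = 1 - 2 * (1 - f) / 3"
  define \<epsilon> where "\<epsilon> = \<kappa> ^ m"
  have "0 \<le> \<kappa>" "\<kappa> \<le> 1" using f by (auto simp: \<kappa>_def)
  then have \<epsilon>: "0 \<le> \<epsilon>" "\<epsilon> \<le> 1" by (auto simp: \<epsilon>_def power_le_one)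
  have Em: "perfect_pairing (E m)" using Suc.prems by simp
  have IH: "(\<Sum>P\<in>UNIV. of_bool (\<forall>i. i \<in> B \<or> P i = pauli_id) * pauli_weight f E m P) \<le> (1 + \<epsilon>) ^ card B" for B
    unfolding \<epsilon>_def \<kappa>_def using Suc.IH Suc.prems by simp
  define c where "c = (\<lambda>e. pair_survival f (fst e \<in> A) (snd e \<in> A))"
  have c: "0 \<le> c e" "c e \<le> 1" for e using pair_survival_bounds[OF f] by (simp_all add: c_def)
  define w where "w = pauli_weight f E m"
  \<comment> \<open>Support restriction and damping at one site, joined so that the whole summand
    factors over the pairs.\<close>
  define t where "t = (\<lambda>i (p :: bool \<times> bool). of_bool (i \<in> A \<or> p = pauli_id) * (if fst p then f else 1))"
  define V where "V = (\<lambda>X :: ('n \<times> 'n) set. \<Union>e\<in>X. {fst e, snd e})"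
  have cardV: "card (V X) = 2 * card X" if "X \<subseteq> E m" for X
  proof -
    have "card (V X) = (\<Sum>e\<in>X. card {fst e, snd e})"
      unfolding V_def
      by (rule card_UN_disjoint) (use that in \<open>auto dest: pairing_unique[OF Em]\<close>)
    also have "\<dots> = (\<Sum>e\<in>X. 2)"
    proof (rule sum.cong)
      fix e assume "e \<in> X"
      with that have "fst e \<noteq> snd e" using pairing_ne[OF Em] by blast
      then show "card {fst e, snd e} = 2" by simp
    qed simp
    finally show ?thesis by simp
  qed
  have V: "(\<forall>e\<in>E m - X. (Q (fst e), Q (snd e)) = (pauli_id, pauli_id)) \<longleftrightarrow> (\<forall>i. i \<in> V X \<or> Q i = pauli_id)"
    if "X \<subseteq> E m" for X and Q :: "'n pauli"
  proof (intro iffI allI ballI)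
    fix i assume *: "\<forall>e\<in>E m - X. (Q (fst e), Q (snd e)) = (pauli_id, pauli_id)"
    obtain e where "e \<in> E m" "i \<in> {fst e, snd e}" using pairing_cover[OF Em] by blast
    with * show "i \<in> V X \<or> Q i = pauli_id" by (cases "e \<in> X") (auto simp: V_def)
  next
    fix e assume *: "\<forall>i. i \<in> V X \<or> Q i = pauli_id" and e: "e \<in> E m - X"
    have "k \<notin> V X" if "k \<in> {fst e, snd e}" for k
      using pairing_unique[OF Em _ _ that] e \<open>X \<subseteq> E m\<close> by (auto simp: V_def)
    then show "(Q (fst e), Q (snd e)) = (pauli_id, pauli_id)" using * by blast
  qed
  have "(\<Sum>P\<in>UNIV. of_bool (\<forall>i. i \<in> A \<or> P i = pauli_id) * pauli_weight f E (Suc m) P) =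
    (\<Sum>P\<in>UNIV. \<Sum>Q\<in>UNIV. (\<Prod>e\<in>E m. t (fst e) (P (fst e)) * t (snd e) (P (snd e)) *
      pauli_mixing (P (fst e), P (snd e)) (Q (fst e), Q (snd e))) * w Q)"
  proof (rule sum.cong)
    fix P :: "'n pauli"
    have "(of_bool (\<forall>i. i \<in> A \<or> P i = pauli_id) :: real) * (\<Prod>i\<in>UNIV. if fst (P i) then f else 1) = (\<Prod>i\<in>UNIV. t i (P i))"
      by (simp only: t_def prod.distrib prod_of_bool[OF finite] ball_UNIV)
    also have "\<dots> = (\<Prod>e\<in>E m. t (fst e) (P (fst e)) * t (snd e) (P (snd e)))"
      by (rule prod_pairing[OF Em])
    finally show "of_bool (\<forall>i. i \<in> A \<or> P i = pauli_id) * pauli_weight f E (Suc m) P =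
      (\<Sum>Q\<in>UNIV. (\<Prod>e\<in>E m. t (fst e) (P (fst e)) * t (snd e) (P (snd e)) *
        pauli_mixing (P (fst e), P (snd e)) (Q (fst e), Q (snd e))) * w Q)"
      by (simp add: w_def prod.distrib sum_distrib_left mult.assoc flip: mult.assoc[of "of_bool _"])
  qed simp
  also have "\<dots> = (\<Sum>Q\<in>UNIV. \<Sum>P\<in>UNIV. (\<Prod>e\<in>E m. t (fst e) (P (fst e)) * t (snd e) (P (snd e)) *
      pauli_mixing (P (fst e), P (snd e)) (Q (fst e), Q (snd e))) * w Q)"
    by (rule sum.swap)
  also have "\<dots> = (\<Sum>Q\<in>UNIV. (\<Prod>e\<in>E m. c e + (1 - c e) * of_bool ((Q (fst e), Q (snd e)) = (pauli_id, pauli_id))) * w Q)"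
  proof (rule sum.cong)
    fix Q :: "'n pauli"
    have "(\<Sum>P\<in>UNIV. \<Prod>e\<in>E m. t (fst e) (P (fst e)) * t (snd e) (P (snd e)) *
        pauli_mixing (P (fst e), P (snd e)) (Q (fst e), Q (snd e))) =
      (\<Prod>e\<in>E m. \<Sum>z\<in>UNIV. t (fst e) (fst z) * t (snd e) (snd z) * pauli_mixing z (Q (fst e), Q (snd e)))"
      using sum_pairing[OF Em, of "\<lambda>e z. t (fst e) (fst z) * t (snd e) (snd z) * pauli_mixing z (Q (fst e), Q (snd e))"]
      by simp
    also have "\<dots> = (\<Prod>e\<in>E m. c e + (1 - c e) * of_bool ((Q (fst e), Q (snd e)) = (pauli_id, pauli_id)))"
      unfolding t_def sum_pauli_mixing c_def by (simp only: add.commute)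
    finally show "(\<Sum>P\<in>UNIV. (\<Prod>e\<in>E m. t (fst e) (P (fst e)) * t (snd e) (P (snd e)) *
        pauli_mixing (P (fst e), P (snd e)) (Q (fst e), Q (snd e))) * w Q) =
      (\<Prod>e\<in>E m. c e + (1 - c e) * of_bool ((Q (fst e), Q (snd e)) = (pauli_id, pauli_id))) * w Q"
      by (simp only: sum_distrib_right[symmetric])
  qed simp
  \<comment> \<open>Multiply out the product over pairs: \<open>X\<close> collects the pairs where
    \<open>c e\<close> is chosen, and the other pairs force \<open>Q\<close> to be the identity
    there.\<close>
  also have "\<dots> = (\<Sum>Q\<in>UNIV. \<Sum>X\<in>Pow (E m). (\<Prod>e\<in>X. c e) * (\<Prod>e\<in>E m - X. 1 - c e) *
      (of_bool (\<forall>i. i \<in> V X \<or> Q i = pauli_id) * w Q))"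
  proof (rule sum.cong)
    fix Q :: "'n pauli"
    have "(\<Prod>e\<in>E m. c e + (1 - c e) * of_bool ((Q (fst e), Q (snd e)) = (pauli_id, pauli_id))) =
      (\<Sum>X\<in>Pow (E m). (\<Prod>e\<in>X. c e) * (\<Prod>e\<in>E m - X. (1 - c e) * of_bool ((Q (fst e), Q (snd e)) = (pauli_id, pauli_id))))"
      by (rule prod_add) simp
    also have "\<dots> = (\<Sum>X\<in>Pow (E m). (\<Prod>e\<in>X. c e) * (\<Prod>e\<in>E m - X. 1 - c e) * of_bool (\<forall>i. i \<in> V X \<or> Q i = pauli_id))"
    proof (rule sum.cong)
      fix X assume "X \<in> Pow (E m)"
      then have X: "X \<subseteq> E m" by simp
      show "(\<Prod>e\<in>X. c e) * (\<Prod>e\<in>E m - X. (1 - c e) * of_bool ((Q (fst e), Q (snd e)) = (pauli_id, pauli_id))) =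
        (\<Prod>e\<in>X. c e) * (\<Prod>e\<in>E m - X. 1 - c e) * of_bool (\<forall>i. i \<in> V X \<or> Q i = pauli_id)"
        by (simp only: prod.distrib prod_of_bool[OF finite] V[OF X] mult.assoc)
    qed simp
    finally show "(\<Prod>e\<in>E m. c e + (1 - c e) * of_bool ((Q (fst e), Q (snd e)) = (pauli_id, pauli_id))) * w Q =
      (\<Sum>X\<in>Pow (E m). (\<Prod>e\<in>X. c e) * (\<Prod>e\<in>E m - X. 1 - c e) * (of_bool (\<forall>i. i \<in> V X \<or> Q i = pauli_id) * w Q))"
      by (simp only: sum_distrib_right mult.assoc)
  qed simp
  also have "\<dots> = (\<Sum>X\<in>Pow (E m). (\<Prod>e\<in>X. c e) * (\<Prod>e\<in>E m - X. 1 - c e) *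
      (\<Sum>Q\<in>UNIV. of_bool (\<forall>i. i \<in> V X \<or> Q i = pauli_id) * w Q))"
    unfolding sum_distrib_left by (rule sum.swap)
  also have "\<dots> \<le> (\<Sum>X\<in>Pow (E m). (\<Prod>e\<in>X. c e) * (\<Prod>e\<in>E m - X. 1 - c e) * (1 + \<epsilon>) ^ card (V X))"
    unfolding w_def by (intro sum_mono mult_left_mono IH mult_nonneg_nonneg prod_nonneg) (use c in auto)
  also have "\<dots> = (\<Sum>X\<in>Pow (E m). (\<Prod>e\<in>X. c e * (1 + \<epsilon>)\<^sup>2) * (\<Prod>e\<in>E m - X. 1 - c e))"
    by (rule sum.cong) (auto simp: cardV prod.distrib power_mult)
  \<comment> \<open>The same expansion read backwards, now with a factor
    \<open>(1 + \<epsilon>)\<^sup>2\<close> for the two sites of each kept pair.\<close>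
  also have "\<dots> = (\<Prod>e\<in>E m. c e * (1 + \<epsilon>)\<^sup>2 + (1 - c e))"
    by (rule prod_add[symmetric]) simp
  also have "\<dots> \<le> (\<Prod>e\<in>E m. (if fst e \<in> A then 1 + \<kappa> * \<epsilon> else 1) * (if snd e \<in> A then 1 + \<kappa> * \<epsilon> else 1))"
  proof (rule prod_mono)
    fix e
    show "0 \<le> c e * (1 + \<epsilon>)\<^sup>2 + (1 - c e) \<and> c e * (1 + \<epsilon>)\<^sup>2 + (1 - c e) \<le>
      (if fst e \<in> A then 1 + \<kappa> * \<epsilon> else 1) * (if snd e \<in> A then 1 + \<kappa> * \<epsilon> else 1)"
      using pair_survival_contraction[OF f \<epsilon>, of "fst e \<in> A" "snd e \<in> A", folded c_def \<kappa>_def]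
        pair_survival_bounds[OF f, of "fst e \<in> A" "snd e \<in> A"]
      by (auto simp: c_def \<kappa>_def)
  qed
  also have "\<dots> = (\<Prod>i\<in>UNIV. if i \<in> A then 1 + \<kappa> * \<epsilon> else 1)"
    by (rule prod_pairing[OF Em, symmetric])
  also have "\<dots> = (1 + \<kappa> * \<epsilon>) ^ card A" by (simp add: prod.If_cases)
  finally show ?case by (simp add: \<epsilon>_def \<kappa>_def)
qed

corollary sum_pauli_weight_le:
  fixes E :: "nat \<Rightarrow> ('n::finite \<times> 'n) set"
  assumes "0 \<le> f" "f \<le> 1" "\<And>k. k < m \<Longrightarrow> perfect_pairing (E k)"
  shows "(\<Sum>P\<in>UNIV. pauli_weight f E m P) \<le> (1 + (1 - 2 * (1 - f) / 3) ^ m) ^ CARD('n)"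
  using pauli_weight_support_le[OF assms, where A=UNIV] by simp

section \<open>Expectations over the ensemble\<close>

text \<open>Fubini's theorem for the coordinates in \<open>J\<close> against the rest. In the
  applications \<open>J\<close> is the current layer and \<open>Y\<close> depends on earlier layers
  only; \<open>dep\<close> lets \<open>Y\<close> remain a function of all coordinates.\<close>

lemma integral_PiM_prod_mult_indep:
  fixes g :: "'i \<Rightarrow> 'a \<Rightarrow> 'b::{real_normed_field,banach,second_countable_topology}"
  assumes M: "\<And>k. prob_space (M k)" and I: "finite I" "J \<subseteq> I"
    and g: "\<And>k. k \<in> J \<Longrightarrow> integrable (M k) (g k)"
    and Y: "integrable (Pi\<^sub>M I M) Y"
    and XY: "integrable (Pi\<^sub>M I M) (\<lambda>u. (\<Prod>k\<in>J. g k (u k)) * Y u)"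
    and dep: "\<And>u u'. (\<And>k. k \<in> I - J \<Longrightarrow> u k = u' k) \<Longrightarrow> Y u = Y u'"
  shows "(\<integral>u. (\<Prod>k\<in>J. g k (u k)) * Y u \<partial>Pi\<^sub>M I M) = (\<Prod>k\<in>J. integral\<^sup>L (M k) (g k)) * integral\<^sup>L (Pi\<^sub>M I M) Y"
proof -
  interpret product_prob_space M
    by (simp add: product_prob_space_def product_prob_space_axioms_def product_sigma_finite_def
        M prob_space_imp_sigma_finite)
  interpret J: prob_space "Pi\<^sub>M J M" by (intro prob_space_PiM M)
  have fin: "finite (I - J)" "finite J" using I by (auto intro: finite_subset)
  have IJ: "(I - J) \<union> J = I" "(I - J) \<inter> J = {}" using I by auto
  have Ym: "Y (merge (I - J) J (x, y)) = Y x" for x y by (rule dep) auto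
  have "(\<integral>u. (\<Prod>k\<in>J. g k (u k)) * Y u \<partial>Pi\<^sub>M I M) =
      (\<integral>x. (\<integral>y. (\<Prod>k\<in>J. g k (merge (I - J) J (x, y) k)) * Y (merge (I - J) J (x, y)) \<partial>Pi\<^sub>M J M) \<partial>Pi\<^sub>M (I - J) M)"
    using product_integral_fold[OF IJ(2) fin, of "\<lambda>u. (\<Prod>k\<in>J. g k (u k)) * Y u"] XY by (simp only: IJ)
  also have "\<dots> = (\<integral>x. (\<integral>y. (\<Prod>k\<in>J. g k (y k)) * Y x \<partial>Pi\<^sub>M J M) \<partial>Pi\<^sub>M (I - J) M)"
    by (simp add: Ym)
  also have "\<dots> = (\<Prod>k\<in>J. integral\<^sup>L (M k) (g k)) * integral\<^sup>L (Pi\<^sub>M (I - J) M) Y"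
    using product_integral_prod[OF fin(2) g] by simp
  \<comment> \<open>The coordinates in \<open>J\<close> are put back at no cost, as their law has
    total mass 1.\<close>
  also have "integral\<^sup>L (Pi\<^sub>M (I - J) M) Y =
      (\<integral>x. (\<integral>y. Y (merge (I - J) J (x, y)) \<partial>Pi\<^sub>M J M) \<partial>Pi\<^sub>M (I - J) M)"
    by (simp add: Ym J.prob_space)
  also have "\<dots> = integral\<^sup>L (Pi\<^sub>M I M) Y"
    using product_integral_fold[OF IJ(2) fin, of Y] Y by (simp only: IJ)
  finally show ?thesis .
qed

lemma prod_singleton_Times: "(\<Prod>k\<in>{m} \<times> A. h k) = (\<Prod>i\<in>A. h (m, i))"
proof -
  have "{m} \<times> A = Pair m ` A" by auto
  then show ?thesis by (simp add: prod.reindex inj_on_def)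
qed

text \<open>Causality: the state after \<open>m\<close> layers is determined by those layers. This
  supplies the hypothesis \<open>dep\<close> of \<open>integral_PiM_prod_mult_indep\<close>.\<close>

lemma noisy_circuit_cong:
  assumes "\<And>k e. k < m \<Longrightarrow> e \<in> E k \<Longrightarrow> u (k, e) = u' (k, e)" "\<And>k i. k < m \<Longrightarrow> b (k, i) = b' (k, i)"
  shows "noisy_circuit q E u b m \<rho> = noisy_circuit q E u' b' m \<rho>"
  using assms
proof (induction m)
  case (Suc m)
  then have "noisy_circuit q E u b m \<rho> = noisy_circuit q E u' b' m \<rho>" by simp
  moreover have "layer_unitary (E m) (\<lambda>e. u (m, e)) = layer_unitary (E m) (\<lambda>e. u' (m, e))"
    by (rule layer_unitary_cong) (simp add: Suc.prems)
  moreover have "{i. b (m, i)} = {i. b' (m, i)}" by (simp add: Suc.prems)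
  ultimately show ?case by simp
qed simp

text \<open>The fixed index set makes each factor a function of one selection bit, as independence
  requires.\<close>

lemma dephasing_factor_Collect:
  fixes P :: "'n::finite pauli"
  shows "dephasing_factor q {i. s i} P = (\<Prod>i\<in>UNIV. if s i \<and> fst (P i) then 1 - 2 * q else 1)"
  unfolding dephasing_factor_def by (rule prod.mono_neutral_cong_left) auto

lemma abs_dephasing_factor_le_1:
  assumes "0 \<le> q" "q \<le> 1"
  shows "\<bar>dephasing_factor q S P\<bar> \<le> 1"
  unfolding dephasing_factor_def abs_prod by (rule prod_le_1) (use assms in auto)

text \<open>The half-averaged quantity: squared coefficients averaged over the gates at fixed noise
  locations \<open>b\<close>.\<close>

primrec located_pauli_weight ::
    "real \<Rightarrow> (nat \<Rightarrow> ('n::finite \<times> 'n) set) \<Rightarrow> (nat \<times> 'n \<Rightarrow> bool) \<Rightarrow> nat \<Rightarrow> 'n pauli \<Rightarrow> real" where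
  "located_pauli_weight q E b 0 P = of_bool (\<forall>i. \<not> fst (P i))"
| "located_pauli_weight q E b (Suc m) P = (dephasing_factor q {i. b (m, i)} P)\<^sup>2 *
     (\<Sum>Q\<in>UNIV. (\<Prod>e\<in>E m. pauli_mixing (P (fst e), P (snd e)) (Q (fst e), Q (snd e))) * located_pauli_weight q E b m Q)"

lemma located_pauli_weight_cong:
  assumes "\<And>k i. k < m \<Longrightarrow> b (k, i) = b' (k, i)"
  shows "located_pauli_weight q E b m P = located_pauli_weight q E b' m P"
  using assms
proof (induction m arbitrary: P)
  case (Suc m)
  then have "located_pauli_weight q E b m Q = located_pauli_weight q E b' m Q" for Q by simp
  moreover have "{i. b (m, i)} = {i. b' (m, i)}" by (simp add: Suc.prems)
  ultimately show ?case by simp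
qed simp

section \<open>Averaging over the gates\<close>

locale noisy_random_circuit =
  fixes E :: "nat \<Rightarrow> ('n::finite \<times> 'n) set" and d :: nat and p q :: real and \<mu> :: "gate measure"
  assumes pairing: "\<And>m. m < d \<Longrightarrow> perfect_pairing (E m)"
    and haar: "haar_measure \<mu>"
    and p: "0 \<le> p" "p \<le> 1" and q: "0 \<le> q" "q \<le> 1"
begin

abbreviation gates :: "(nat \<times> 'n \<times> 'n) set" where "gates \<equiv> SIGMA m:{..<d}. E m"
abbreviation sites :: "(nat \<times> 'n) set" where "sites \<equiv> {..<d} \<times> UNIV"
abbreviation gate_law :: "(nat \<times> 'n \<times> 'n \<Rightarrow> gate) measure" where "gate_law \<equiv> Pi\<^sub>M gates (\<lambda>_. \<mu>)"
abbreviation noise_law :: "(nat \<times> 'n \<Rightarrow> bool) measure" where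
  "noise_law \<equiv> Pi\<^sub>M sites (\<lambda>_. measure_pmf (bernoulli_pmf p))"

definition coeff :: "nat \<Rightarrow> 'n pauli \<Rightarrow> (nat \<times> 'n \<times> 'n \<Rightarrow> gate) \<Rightarrow> (nat \<times> 'n \<Rightarrow> bool) \<Rightarrow> complex" where
  "coeff m P u b = pauli_coeff P (noisy_circuit q E u b m zero_state)"

sublocale gate: prob_space \<mu> using haar by (simp add: haar_measure_def)
sublocale gate_law: prob_space gate_law by (intro prob_space_PiM gate.prob_space_axioms)
sublocale noise_law: prob_space noise_law by (intro prob_space_PiM measure_pmf.prob_space_axioms)
sublocale joint: pair_prob_space gate_law noise_law ..

lemma finite_gates: "finite gates" by (intro finite_SigmaI) auto
lemma finite_sites: "finite sites" by auto

lemma gate_unitary: "u \<in> space gate_law \<Longrightarrow> m < d \<Longrightarrow> e \<in> E m \<Longrightarrow> u (m, e) \<in> unitary_group"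
  using PiE_mem[of u gates "\<lambda>_. space \<mu>" "(m, e)"] by (simp add: space_PiM haar_space[OF haar])

lemma coeff_0: "coeff 0 P u b = of_bool (\<forall>i. \<not> fst (P i))"
  by (simp add: coeff_def pauli_coeff_zero_state)

lemma coeff_Suc:
  assumes "m < d"
  shows "coeff (Suc m) P u b = of_real (dephasing_factor q {i. b (m, i)} P) *
    (\<Sum>Q\<in>UNIV. (\<Prod>e\<in>E m. gate_transfer (u (m, e)) (P (fst e), P (snd e)) (Q (fst e), Q (snd e))) * coeff m Q u b)"
  by (simp add: coeff_def pauli_coeff_dephase_sites pauli_coeff_layer[OF pairing[OF assms]])

text \<open>A crude bound, growing by the number of strings in each layer, that serves
  integrability.\<close>

lemma norm_coeff_le:
  assumes "u \<in> space gate_law" "m \<le> d"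
  shows "cmod (coeff m P u b) \<le> real (card (UNIV :: 'n pauli set)) ^ m"
  using assms(2)
proof (induction m arbitrary: P)
  case (Suc m)
  have "cmod (coeff (Suc m) P u b) \<le> 1 * (\<Sum>Q\<in>(UNIV :: 'n pauli set). 1 * real (card (UNIV :: 'n pauli set)) ^ m)"
    unfolding coeff_Suc[OF Suc_le_lessD[OF Suc.prems]] norm_mult norm_of_real
  proof (intro mult_mono sum_norm_le)
    fix Q
    have "cmod (\<Prod>e\<in>E m. gate_transfer (u (m, e)) (P (fst e), P (snd e)) (Q (fst e), Q (snd e))) \<le> 1"
      unfolding prod_norm[symmetric]
      by (rule prod_le_1) (use Suc.prems in \<open>auto intro!: norm_gate_transfer_le gate_unitary[OF assms(1)]\<close>)
    then show "cmod ((\<Prod>e\<in>E m. gate_transfer (u (m, e)) (P (fst e), P (snd e)) (Q (fst e), Q (snd e))) * coeff m Q u b)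
        \<le> 1 * real (card (UNIV :: 'n pauli set)) ^ m"
      unfolding norm_mult using Suc by (intro mult_mono) auto
  qed (use abs_dephasing_factor_le_1[OF q] in \<open>auto intro: sum_nonneg\<close>)
  then show ?case by simp
qed (simp add: coeff_0)

lemma measurable_coeff:
  assumes "m \<le> d"
  shows "(\<lambda>w. coeff m P (fst w) (snd w)) \<in> borel_measurable (gate_law \<Otimes>\<^sub>M noise_law)"
  using assms
proof (induction m arbitrary: P)
  case (Suc m)
  then have m: "m < d" by simp
  have noise: "(\<lambda>w. complex_of_real (dephasing_factor q {i. snd w (m, i)} P)) \<in> borel_measurable (gate_law \<Otimes>\<^sub>M noise_law)"
  proof -
    have "(\<lambda>w. if snd w (m, i) \<and> fst (P i) then 1 - 2 * q else 1) \<in> borel_measurable (gate_law \<Otimes>\<^sub>M noise_law)" for i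
    proof -
      have "(\<lambda>w. snd w (m, i)) \<in> gate_law \<Otimes>\<^sub>M noise_law \<rightarrow>\<^sub>M measure_pmf (bernoulli_pmf p)"
        using m by (intro measurable_compose[OF measurable_snd] measurable_component_singleton) auto
      from measurable_compose[OF this, of "\<lambda>s. if s \<and> fst (P i) then 1 - 2 * q else 1" borel]
      show ?thesis by simp
    qed
    then have "(\<lambda>w. dephasing_factor q {i. snd w (m, i)} P) \<in> borel_measurable (gate_law \<Otimes>\<^sub>M noise_law)"
      unfolding dephasing_factor_Collect by (intro borel_measurable_prod)
    then show ?thesis
      by (rule measurable_compose) (intro borel_measurable_continuous_onI continuous_intros)
  qed
  have gate: "(\<lambda>w. gate_transfer (fst w (m, e)) r s) \<in> borel_measurable (gate_law \<Otimes>\<^sub>M noise_law)" if "e \<in> E m" for e r s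
  proof -
    have "(\<lambda>w. fst w (m, e)) \<in> gate_law \<Otimes>\<^sub>M noise_law \<rightarrow>\<^sub>M \<mu>"
      using m that by (intro measurable_compose[OF measurable_fst] measurable_component_singleton) auto
    then show ?thesis
      by (rule measurable_compose) (intro haar_measurable_continuous[OF haar] continuous_gate_transfer)
  qed
  show ?case
    unfolding coeff_Suc[OF m] using Suc
    by (intro borel_measurable_times noise borel_measurable_sum borel_measurable_prod gate) auto
qed (simp add: coeff_0)

lemma measurable_coeff_gates:
  assumes "m \<le> d" "b \<in> space noise_law"
  shows "(\<lambda>u. coeff m P u b) \<in> borel_measurable gate_law"
  using measurable_Pair1[OF measurable_coeff[OF assms(1)] assms(2)] by simp

lemma integrable_coeff_mult:
  assumes "m \<le> d" "b \<in> space noise_law"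
  shows "integrable gate_law (\<lambda>u. coeff m P u b * cnj (coeff m Q u b))"
proof (rule gate_law.integrable_const_bound)
  let ?K = "real (card (UNIV :: 'n pauli set)) ^ m"
  show "AE u in gate_law. cmod (coeff m P u b * cnj (coeff m Q u b)) \<le> ?K * ?K"
    by (intro AE_I2) (simp add: norm_mult mult_mono norm_coeff_le[OF _ assms(1)])
  have "(\<lambda>u. cnj (coeff m Q u b)) \<in> borel_measurable gate_law"
    by (rule measurable_compose[OF measurable_coeff_gates[OF assms]])
       (intro borel_measurable_continuous_onI continuous_intros)
  then show "(\<lambda>u. coeff m P u b * cnj (coeff m Q u b)) \<in> borel_measurable gate_law"
    by (intro borel_measurable_times measurable_coeff_gates[OF assms])
qed

text \<open>Squaring \<open>coeff_Suc\<close> gives a double sum over \<open>Q\<close> and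
  \<open>Q'\<close>. The factor \<open>X\<close> contains the gates of layer \<open>m\<close> and
  \<open>Y\<close> those before it, so their averages multiply, and the Haar average removes the
  terms with \<open>Q \<noteq> Q'\<close>.\<close>

lemma integral_coeff_gates:
  assumes b: "b \<in> space noise_law" and "m \<le> d"
  shows "(\<integral>u. coeff m P u b * cnj (coeff m P u b) \<partial>gate_law) = of_real (located_pauli_weight q E b m P)"
  using assms(2)
proof (induction m arbitrary: P)
  case 0
  then show ?case by (simp add: coeff_0 gate_law.prob_space)
next
  case (Suc m)
  then have m: "m < d" "m \<le> d" by auto
  define J where "J = {m} \<times> E m"
  define s where "s = dephasing_factor q {i. b (m, i)} P"
  define G where "G = (\<lambda>Q Q' (k :: nat \<times> 'n \<times> 'n). gate_transfer2 (P (fst (snd k)), P (snd (snd k)))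
    (Q (fst (snd k)), Q (snd (snd k))) (Q' (fst (snd k)), Q' (snd (snd k))))"
  define X where "X = (\<lambda>Q Q' u. \<Prod>k\<in>J. G Q Q' k (u k))"
  define Y where "Y = (\<lambda>Q Q' u. coeff m Q u b * cnj (coeff m Q' u b))"
  have J: "J \<subseteq> gates" using m by (auto simp: J_def)
  have expand: "coeff (Suc m) P u b * cnj (coeff (Suc m) P u b) =
    (\<Sum>Q\<in>UNIV. \<Sum>Q'\<in>UNIV. of_real (s\<^sup>2) * (X Q Q' u * Y Q Q' u))" for u
  proof -
    define a where "a = (\<lambda>Q. (\<Prod>e\<in>E m. gate_transfer (u (m, e)) (P (fst e), P (snd e)) (Q (fst e), Q (snd e))) * coeff m Q u b)"
    have "coeff (Suc m) P u b = of_real s * (\<Sum>Q\<in>UNIV. a Q)"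
      by (simp add: coeff_Suc[OF m(1)] a_def s_def)
    then have "coeff (Suc m) P u b * cnj (coeff (Suc m) P u b) =
        of_real (s\<^sup>2) * ((\<Sum>Q\<in>UNIV. a Q) * (\<Sum>Q'\<in>UNIV. cnj (a Q')))"
      by (simp add: power2_eq_square)
    also have "\<dots> = (\<Sum>Q\<in>UNIV. \<Sum>Q'\<in>UNIV. of_real (s\<^sup>2) * (a Q * cnj (a Q')))"
      by (simp only: sum_product) (simp only: sum_distrib_left)
    also have "\<dots> = (\<Sum>Q\<in>UNIV. \<Sum>Q'\<in>UNIV. of_real (s\<^sup>2) * (X Q Q' u * Y Q Q' u))"
      by (simp add: a_def X_def Y_def J_def prod_singleton_Times G_def prod.distrib mult_ac)
    finally show ?thesis .
  qed
  have Xb: "cmod (X Q Q' u) \<le> 1" if "u \<in> space gate_law" for Q Q' u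
    unfolding X_def J_def prod_singleton_Times prod_norm[symmetric] G_def
    using m(1) by (intro prod_le_1) (auto simp: norm_mult intro!: mult_le_one norm_gate_transfer_le gate_unitary[OF that])
  have Xm: "X Q Q' \<in> borel_measurable gate_law" for Q Q'
    unfolding X_def
  proof (rule borel_measurable_prod)
    fix k assume "k \<in> J"
    then have "(\<lambda>u. u k) \<in> gate_law \<rightarrow>\<^sub>M \<mu>"
      using J by (intro measurable_component_singleton) auto
    then show "(\<lambda>u. G Q Q' k (u k)) \<in> borel_measurable gate_law"
      by (rule measurable_compose) (unfold G_def, rule gate_transfer2_measurable[OF haar])
  qed
  have Yi: "integrable gate_law (Y Q Q')" for Q Q'
    unfolding Y_def by (rule integrable_coeff_mult[OF m(2) b])
  have XYi: "integrable gate_law (\<lambda>u. X Q Q' u * Y Q Q' u)" for Q Q'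
  proof (rule Bochner_Integration.integrable_bound[OF Yi[of Q Q']])
    show "AE u in gate_law. cmod (X Q Q' u * Y Q Q' u) \<le> cmod (Y Q Q' u)"
      by (intro AE_I2) (simp add: norm_mult mult_left_le_one_le Xb)
  qed (intro borel_measurable_times Xm borel_measurable_integrable[OF Yi])
  have int: "(\<integral>u. X Q Q' u * Y Q Q' u \<partial>gate_law) = of_bool (Q = Q') *
      of_real ((\<Prod>e\<in>E m. pauli_mixing (P (fst e), P (snd e)) (Q (fst e), Q (snd e))) * located_pauli_weight q E b m Q)" for Q Q'
  proof -
    have "(\<integral>u. X Q Q' u * Y Q Q' u \<partial>gate_law) = (\<Prod>k\<in>J. integral\<^sup>L \<mu> (G Q Q' k)) * integral\<^sup>L gate_law (Y Q Q')"
      unfolding X_def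
    proof (rule integral_PiM_prod_mult_indep)
      show "Y Q Q' u = Y Q Q' u'" if "\<And>k. k \<in> gates - J \<Longrightarrow> u k = u' k" for u u'
      proof -
        have "noisy_circuit q E u b m zero_state = noisy_circuit q E u' b m zero_state"
          by (rule noisy_circuit_cong) (use that m in \<open>auto simp: J_def\<close>)
        then show ?thesis by (simp add: Y_def coeff_def)
      qed
      show "integrable \<mu> (G Q Q' k)" for k
        unfolding G_def by (rule gate_transfer2_integrable[OF haar])
    qed (use gate.prob_space_axioms finite_gates J Yi XYi in \<open>auto simp: X_def\<close>)
    also have "(\<Prod>k\<in>J. integral\<^sup>L \<mu> (G Q Q' k)) =
        (\<Prod>e\<in>E m. of_real (pauli_mixing (P (fst e), P (snd e)) (Q (fst e), Q (snd e)))) *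
        of_bool (\<forall>e\<in>E m. (Q (fst e), Q (snd e)) = (Q' (fst e), Q' (snd e)))"
      unfolding J_def prod_singleton_Times G_def haar_integral_gate_transfer[OF haar]
      by (simp only: prod.distrib prod_of_bool[OF finite] fst_conv snd_conv)
    \<comment> \<open>Agreement on every pair is agreement everywhere, since the pairs cover all
      sites.\<close>
    also have "(\<forall>e\<in>E m. (Q (fst e), Q (snd e)) = (Q' (fst e), Q' (snd e))) \<longleftrightarrow> Q = Q'"
      using pairing_cover[OF pairing[OF m(1)]] by (fastforce simp: fun_eq_iff)
    finally show ?thesis using Suc.IH[OF m(2)] by (auto simp: Y_def)
  qed
  have "(\<integral>u. coeff (Suc m) P u b * cnj (coeff (Suc m) P u b) \<partial>gate_law) =
    (\<Sum>Q\<in>UNIV. \<Sum>Q'\<in>UNIV. of_real (s\<^sup>2) * (\<integral>u. X Q Q' u * Y Q Q' u \<partial>gate_law))"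
    unfolding expand by (simp add: Bochner_Integration.integral_sum XYi)
  also have "\<dots> = (\<Sum>Q\<in>UNIV. \<Sum>Q'\<in>UNIV. if Q = Q' then of_real (s\<^sup>2 * ((\<Prod>e\<in>E m. pauli_mixing (P (fst e), P (snd e)) (Q (fst e), Q (snd e))) * located_pauli_weight q E b m Q)) else 0)"
    unfolding int by (intro sum.cong refl) auto
  also have "\<dots> = of_real (located_pauli_weight q E b (Suc m) P)"
    by (simp add: s_def sum_distrib_left)
  finally show ?case .
qed

section \<open>Averaging over the noise locations\<close>

text \<open>The mean \<open>(1 - p) + p * (1 - 2 * q)\<^sup>2\<close> of the squared dephasing
  factor of an X or Y.\<close>

definition damping :: real where "damping = 1 - 4 * p * q * (1 - q)"

lemma measurable_located_pauli_weight:
  assumes "m \<le> d"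
  shows "(\<lambda>b. located_pauli_weight q E b m P) \<in> borel_measurable noise_law"
  using assms
proof (induction m arbitrary: P)
  case (Suc m)
  have "(\<lambda>b. if b (m, i) \<and> fst (P i) then 1 - 2 * q else 1) \<in> borel_measurable noise_law" for i
  proof -
    have "(\<lambda>b. b (m, i)) \<in> noise_law \<rightarrow>\<^sub>M measure_pmf (bernoulli_pmf p)"
      using Suc.prems by (intro measurable_component_singleton) auto
    from measurable_compose[OF this, of "\<lambda>s. if s \<and> fst (P i) then 1 - 2 * q else 1" borel]
    show ?thesis by simp
  qed
  then show ?case
    unfolding located_pauli_weight.simps dephasing_factor_Collect using Suc
    by (intro borel_measurable_times borel_measurable_power borel_measurable_prod borel_measurable_sum
        borel_measurable_const) auto
qed simp

lemma located_pauli_weight_bounds: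
  "0 \<le> located_pauli_weight q E b m P \<and> located_pauli_weight q E b m P \<le> real (card (UNIV :: 'n pauli set)) ^ m"
proof (induction m arbitrary: P)
  case (Suc m)
  have "located_pauli_weight q E b (Suc m) P \<le> 1 * (\<Sum>Q\<in>(UNIV :: 'n pauli set). 1 * real (card (UNIV :: 'n pauli set)) ^ m)"
    unfolding located_pauli_weight.simps
    by (intro mult_mono sum_mono prod_le_1 sum_nonneg mult_nonneg_nonneg prod_nonneg)
       (use Suc abs_dephasing_factor_le_1[OF q] in \<open>auto simp: pauli_mixing_nonneg pauli_mixing_le_1 abs_square_le_1\<close>)
  moreover have "0 \<le> located_pauli_weight q E b (Suc m) P"
    unfolding located_pauli_weight.simps
    by (intro sum_nonneg mult_nonneg_nonneg prod_nonneg) (use Suc in \<open>auto simp: pauli_mixing_nonneg\<close>)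
  ultimately show ?case by simp
qed simp

lemma integrable_located_pauli_weight:
  assumes "m \<le> d"
  shows "integrable noise_law (\<lambda>b. located_pauli_weight q E b m P)"
  by (rule noise_law.integrable_const_bound[OF _ measurable_located_pauli_weight[OF assms]])
     (use located_pauli_weight_bounds in \<open>auto intro!: AE_I2\<close>)

text \<open>The selections in layer \<open>m\<close> are independent of each other and of earlier
  layers, so each squared factor may be replaced by its mean.\<close>

lemma integral_located_pauli_weight:
  assumes "m \<le> d"
  shows "(\<integral>b. located_pauli_weight q E b m P \<partial>noise_law) = pauli_weight damping E m P"
  using assms
proof (induction m arbitrary: P)
  case 0
  then show ?case by (simp add: noise_law.prob_space)
next
  case (Suc m)
  then have m: "m < d" "m \<le> d" by auto
  define J where "J = {m} \<times> (UNIV :: 'n set)"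
  define g where "g = (\<lambda>(k :: nat \<times> 'n) s. if s \<and> fst (P (snd k)) then (1 - 2 * q)\<^sup>2 else 1)"
  define Y where "Y = (\<lambda>b. \<Sum>Q\<in>UNIV. (\<Prod>e\<in>E m. pauli_mixing (P (fst e), P (snd e)) (Q (fst e), Q (snd e))) * located_pauli_weight q E b m Q)"
  have J: "J \<subseteq> sites" using m by (auto simp: J_def)
  have W: "located_pauli_weight q E b (Suc m) P = (\<Prod>k\<in>J. g k (b k)) * Y b" for b
  proof -
    have "(dephasing_factor q {i. b (m, i)} P)\<^sup>2 = (\<Prod>k\<in>J. g k (b k))"
      unfolding J_def prod_singleton_Times g_def dephasing_factor_Collect prod_power_distrib
      by (rule prod.cong) auto
    then show ?thesis by (simp add: Y_def)
  qed
  have Yi: "integrable noise_law Y"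
    unfolding Y_def using integrable_located_pauli_weight[OF m(2)] by simp
  have "(\<integral>b. (\<Prod>k\<in>J. g k (b k)) * Y b \<partial>noise_law) =
      (\<Prod>k\<in>J. integral\<^sup>L (measure_pmf (bernoulli_pmf p)) (g k)) * integral\<^sup>L noise_law Y"
  proof (rule integral_PiM_prod_mult_indep)
    show "integrable noise_law (\<lambda>b. (\<Prod>k\<in>J. g k (b k)) * Y b)"
      unfolding W[symmetric] by (rule integrable_located_pauli_weight[OF Suc.prems])
    show "Y b = Y b'" if "\<And>k. k \<in> sites - J \<Longrightarrow> b k = b' k" for b b'
    proof -
      have "located_pauli_weight q E b m Q = located_pauli_weight q E b' m Q" for Q
        by (rule located_pauli_weight_cong) (use that m in \<open>auto simp: J_def\<close>)
      then show ?thesis by (simp add: Y_def)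
    qed
    show "integrable (measure_pmf (bernoulli_pmf p)) (g k)" for k
      by (rule integrable_measure_pmf_finite) simp
  qed (use measure_pmf.prob_space_axioms finite_sites J Yi in auto)
  also have "(\<Prod>k\<in>J. integral\<^sup>L (measure_pmf (bernoulli_pmf p)) (g k)) = (\<Prod>i\<in>UNIV. if fst (P i) then damping else 1)"
    unfolding J_def prod_singleton_Times
    by (rule prod.cong) (auto simp: g_def p damping_def power2_eq_square algebra_simps)
  also have "integral\<^sup>L noise_law Y =
      (\<Sum>Q\<in>UNIV. (\<Prod>e\<in>E m. pauli_mixing (P (fst e), P (snd e)) (Q (fst e), Q (snd e))) * pauli_weight damping E m Q)"
    unfolding Y_def using Suc.IH[OF m(2)] integrable_located_pauli_weight[OF m(2)]
    by (simp add: Bochner_Integration.integral_sum)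
  finally show ?case by (simp only: W pauli_weight.simps)
qed

text \<open>Fubini's theorem with the gates integrated first, at fixed noise locations.\<close>

lemma integral_norm_coeff:
  "integrable (gate_law \<Otimes>\<^sub>M noise_law) (\<lambda>(u, b). (cmod (coeff d P u b))\<^sup>2)" (is ?I)
  "(\<integral>(u, b). (cmod (coeff d P u b))\<^sup>2 \<partial>(gate_law \<Otimes>\<^sub>M noise_law)) = pauli_weight damping E d P"
proof -
  show ?I
  proof (rule joint.integrable_const_bound)
    let ?K = "real (card (UNIV :: 'n pauli set)) ^ d"
    show "AE w in gate_law \<Otimes>\<^sub>M noise_law. norm (case w of (u, b) \<Rightarrow> (cmod (coeff d P u b))\<^sup>2) \<le> ?K\<^sup>2"
      by (intro AE_I2) (auto simp: space_pair_measure intro!: power_mono norm_coeff_le)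
    show "(\<lambda>(u, b). (cmod (coeff d P u b))\<^sup>2) \<in> borel_measurable (gate_law \<Otimes>\<^sub>M noise_law)"
      unfolding case_prod_beta
      by (intro borel_measurable_power measurable_compose[OF measurable_coeff[OF order_refl] borel_measurable_norm])
  qed
  have "(\<integral>u. (cmod (coeff d P u b))\<^sup>2 \<partial>gate_law) = located_pauli_weight q E b d P" if "b \<in> space noise_law" for b
  proof -
    have "of_real (\<integral>u. (cmod (coeff d P u b))\<^sup>2 \<partial>gate_law) = (\<integral>u. coeff d P u b * cnj (coeff d P u b) \<partial>gate_law)"
      by (simp only: complex_norm_square[symmetric] integral_complex_of_real)
    then show ?thesis using integral_coeff_gates[OF that order_refl, of P] by (simp only: of_real_eq_iff)
  qed
  then have "(\<integral>b. (\<integral>u. (cmod (coeff d P u b))\<^sup>2 \<partial>gate_law) \<partial>noise_law) = pauli_weight damping E d P"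
    unfolding integral_located_pauli_weight[OF order_refl, symmetric]
    by (intro Bochner_Integration.integral_cong refl)
  then show "(\<integral>(u, b). (cmod (coeff d P u b))\<^sup>2 \<partial>(gate_law \<Otimes>\<^sub>M noise_law)) = pauli_weight damping E d P"
    using joint.integral_snd[OF \<open>?I\<close>] by simp
qed

section \<open>From second moments to the expected distance\<close>

lemma trace_circuit:
  assumes "u \<in> space gate_law" "m \<le> d"
  shows "trace (noisy_circuit q E u b m zero_state) = 1"
  using assms(2)
proof (induction m)
  case (Suc m)
  then have "layer_unitary (E m) (\<lambda>e. u (m, e)) \<in> unitary_group"
    using gate_unitary[OF assms(1)] pairing by (intro layer_unitary_in_unitary_group) auto
  then show ?case
    using Suc by (simp add: trace_dephase_sites unitary_channel_def trace_unitary_conj)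
qed (simp add: trace_zero_state)

lemma pos_semidef_circuit: "pos_semidef (noisy_circuit q E u b m zero_state)"
  by (induction m)
     (simp_all add: pos_semidef_zero_state pos_semidef_dephase_sites unitary_channel_def pos_semidef_conj q)

abbreviation distance :: "(nat \<times> 'n \<times> 'n \<Rightarrow> gate) \<Rightarrow> (nat \<times> 'n \<Rightarrow> bool) \<Rightarrow> real" where
  "distance u b \<equiv> tv_dist (output_dist q E d u b) uniform_dist"

lemma distance_le_1: "u \<in> space gate_law \<Longrightarrow> distance u b \<le> 1"
  using trace_circuit[of u d b]
  by (intro tv_dist_le_1)
     (simp_all add: output_dist_def pos_semidef_diag pos_semidef_circuit sum_uniform_dist trace_def
        uniform_dist_def card_fun flip: Re_sum)

lemma distance_square_le:
  "u \<in> space gate_law \<Longrightarrow> (2 * distance u b)\<^sup>2 \<le> (\<Sum>P\<in>UNIV. (cmod (coeff d P u b))\<^sup>2) - 1"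
  using tv_dist_uniform_le_pauli[OF trace_circuit[of u d b]] by (simp add: output_dist_def[abs_def] coeff_def)

lemma expected_distance_le_1: "(\<integral>(u, b). distance u b \<partial>(gate_law \<Otimes>\<^sub>M noise_law)) \<le> 1"
\<comment> \<open>The integral of a non-integrable function is 0 by convention, so the bound holds
  in either case.\<close>
proof (cases "integrable (gate_law \<Otimes>\<^sub>M noise_law) (\<lambda>(u, b). distance u b)")
  case True
  have "(\<integral>(u, b). distance u b \<partial>(gate_law \<Otimes>\<^sub>M noise_law)) \<le> (\<integral>w. 1 \<partial>(gate_law \<Otimes>\<^sub>M noise_law))"
    by (rule integral_mono[OF True]) (auto simp: space_pair_measure distance_le_1)
  then show ?thesis by (simp add: joint.prob_space)
qed (simp add: not_integrable_integral_eq)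

text \<open>Here \<open>t\<close> is a positive bound for the square root of the expected
  non-identity weight, which dominates \<open>(2 * distance u b)\<^sup>2\<close> in the
  mean.\<close>

lemma expected_distance_le:
  assumes t: "0 < t" and le: "(\<Sum>P\<in>UNIV. pauli_weight damping E d P) - 1 \<le> t\<^sup>2"
  shows "(\<integral>(u, b). distance u b \<partial>(gate_law \<Otimes>\<^sub>M noise_law)) \<le> t / 2"
proof (cases "integrable (gate_law \<Otimes>\<^sub>M noise_law) (\<lambda>(u, b). distance u b)")
  case True
  let ?M = "gate_law \<Otimes>\<^sub>M noise_law"
  define K where "K = (\<lambda>w. (\<Sum>P\<in>UNIV. (case w of (u, b) \<Rightarrow> (cmod (coeff d P u b))\<^sup>2)) - 1)"
  have sumi: "integrable ?M (\<lambda>w. \<Sum>P\<in>UNIV. (case w of (u, b) \<Rightarrow> (cmod (coeff d P u b))\<^sup>2))"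
    by (rule Bochner_Integration.integrable_sum) (rule integral_norm_coeff)
  then have Ki: "integrable ?M K" unfolding K_def by simp
  have "integral\<^sup>L ?M K = (\<Sum>P\<in>UNIV. pauli_weight damping E d P) - 1"
    unfolding K_def
    by (simp add: Bochner_Integration.integral_diff[OF sumi] Bochner_Integration.integral_sum integral_norm_coeff joint.prob_space)
  with le have K: "integral\<^sup>L ?M K \<le> t\<^sup>2" by simp
  \<comment> \<open>AM-GM in place of Jensen's inequality.\<close>
  have "(\<integral>(u, b). distance u b \<partial>?M) \<le> (\<integral>w. (K w / t + t) / 4 \<partial>?M)"
  proof (rule integral_mono[OF True])
    fix w assume "w \<in> space ?M"
    then obtain u b where w: "w = (u, b)" "u \<in> space gate_law" by (auto simp: space_pair_measure)
    have "4 * distance u b * t \<le> (2 * distance u b)\<^sup>2 + t\<^sup>2"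
      using sum_squares_bound[of "2 * distance u b" t] by simp
    also have "\<dots> \<le> K w + t\<^sup>2" using distance_square_le[OF w(2)] by (simp add: K_def w)
    finally show "(case w of (u, b) \<Rightarrow> distance u b) \<le> (K w / t + t) / 4"
      using t by (simp add: w field_simps power2_eq_square)
  qed (use Ki in simp)
  also have "\<dots> = (integral\<^sup>L ?M K / t + t) / 4"
    using Ki by (simp add: joint.prob_space)
  also have "\<dots> \<le> (t\<^sup>2 / t + t) / 4"
    using K t by (intro divide_right_mono add_right_mono) auto
  also have "\<dots> = t / 2" using t by (simp add: power2_eq_square)
  finally show ?thesis .
qed (use t in \<open>simp add: not_integrable_integral_eq\<close>)

end

section \<open>The two regimes of the bound\<close>

theorem theorem2:
  fixes P :: "nat \<Rightarrow> ('n::finite \<times> 'n) set"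
    and d :: nat
    and p q \<gamma> :: real
    and \<mu> :: "gate measure"
  assumes "even CARD('n)"
    and "\<And>m. m < d \<Longrightarrow> perfect_pairing (P m)"
    and "haar_measure \<mu>"
    and "0 \<le> p" and "p \<le> 1"
    and "0 \<le> q" and "q \<le> 1"
    and "\<gamma> = 8 * q * (1 - q) / 3"
  shows "(\<integral>(u, b). tv_dist (output_dist q P d u b) uniform_dist \<partial>circuit_ensemble \<mu> p P d)
    < 3 powr (2/3) / 2 * real CARD('n) powr (1/3) * exp (- \<gamma> * p * real d / 3)"
proof -
  interpret noisy_random_circuit P d p q \<mu> by unfold_locales (use assms in auto)
  \<comment> \<open>The right-hand side depends on the number of qubits and the depth through
    \<open>x\<close> alone.\<close>
  define x where "x = real CARD('n) * exp (- \<gamma> * p * real d)"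
  have x0: "0 < x" by (simp add: x_def)
  have rhs: "3 powr (2/3) / 2 * real CARD('n) powr (1/3) * exp (- \<gamma> * p * real d / 3) = 3 powr (2/3) / 2 * x powr (1/3)"
    by (simp add: x_def powr_mult exp_powr_real)
  have "(\<integral>(u, b). distance u b \<partial>(gate_law \<Otimes>\<^sub>M noise_law)) < 3 powr (2/3) / 2 * x powr (1/3)"
  proof (cases "1 \<le> x")
    case True
    \<comment> \<open>The prefactor exceeds 1 because 9 exceeds 8, so the trivial bound 1 on the
      distance suffices.\<close>
    have "2 = (8::real) powr (1/3)"
      using powr_powr[of "2::real" 3 "1/3"] by simp
    also have "\<dots> < 9 powr (1/3)" by (rule powr_less_mono2) auto
    also have "9 powr (1/3) = (3::real) powr (2/3)"
      using powr_powr[of 3 2 "1/3"] by simp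
    finally have "1 < 3 powr (2/3) / 2 * (1::real)" by simp
    also have "\<dots> \<le> 3 powr (2/3) / 2 * x powr (1/3)"
      using True by (intro mult_left_mono ge_one_powr_ge_zero) auto
    finally show ?thesis using expected_distance_le_1 by linarith
  next
    case False
    define t where "t = sqrt (exp x - 1)"
    have damping: "0 \<le> damping" "damping \<le> 1"
    proof -
      have "4 * (q * (1 - q)) \<le> 1"
        using zero_le_power2[of "1 - 2 * q"] by (simp add: power2_eq_square algebra_simps)
      then have "p * (4 * (q * (1 - q))) \<le> 1 * 1" using p q by (intro mult_mono) auto
      then show "0 \<le> damping" by (simp add: damping_def mult_ac)
      show "damping \<le> 1" using p q by (simp add: damping_def)
    qed
    define \<epsilon> where "\<epsilon> = (1 - 2 * (1 - damping) / 3) ^ d"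
    \<comment> \<open>This identity is where the value of \<gamma> comes from: the contraction rate
      per layer is \<open>1 - \<gamma> * p\<close>.\<close>
    have "2 * (1 - damping) / 3 = \<gamma> * p" by (simp add: damping_def assms(8))
    then have "1 - 2 * (1 - damping) / 3 \<le> exp (- (\<gamma> * p))"
      using exp_ge_add_one_self[of "- (\<gamma> * p)"] by simp
    then have "\<epsilon> \<le> exp (- (\<gamma> * p)) ^ d"
      unfolding \<epsilon>_def using damping by (intro power_mono) auto
    then have \<epsilon>: "\<epsilon> \<le> exp (- \<gamma> * p * real d)" by (simp add: exp_of_nat_mult[symmetric] mult_ac)
    have "0 \<le> \<epsilon>" using damping by (simp add: \<epsilon>_def)
    have "(\<Sum>Q\<in>UNIV. pauli_weight damping P d Q) \<le> (1 + \<epsilon>) ^ CARD('n)"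
      unfolding \<epsilon>_def by (rule sum_pauli_weight_le[OF damping pairing])
    also have "\<dots> \<le> exp \<epsilon> ^ CARD('n)" using \<open>0 \<le> \<epsilon>\<close> by (intro power_mono exp_ge_add_one_self) auto
    also have "\<dots> = exp (real CARD('n) * \<epsilon>)" by (simp add: exp_of_nat_mult)
    also have "\<dots> \<le> exp x" using \<epsilon> by (simp add: x_def)
    finally have "(\<Sum>Q\<in>UNIV. pauli_weight damping P d Q) - 1 \<le> t\<^sup>2" using x0 by (simp add: t_def)
    moreover have "0 < t" using x0 by (simp add: t_def)
    ultimately have "(\<integral>(u, b). distance u b \<partial>(gate_law \<Otimes>\<^sub>M noise_law)) \<le> t / 2"
      by (rule expected_distance_le[rotated])
    moreover have "t < 3 powr (2/3) * x powr (1/3)"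
    proof -
      \<comment> \<open>For \<open>x < 1\<close> this gives \<open>exp x - 1 \<le> 2 * x\<close>;
        enlarging 2 to 3 makes the final inequality strict.\<close>
      have "exp x \<le> 1 + x + x\<^sup>2" using False x0 by (intro exp_bound) auto
      moreover have "x\<^sup>2 \<le> x" using False x0 by (simp add: power2_eq_square)
      ultimately have "t \<le> sqrt (2 * x)" unfolding t_def by (intro real_sqrt_le_mono) auto
      also have "\<dots> < sqrt (3 * x)" using x0 by simp
      also have "\<dots> = 3 powr (1/2) * x powr (1/2)"
        using x0 by (simp add: powr_half_sqrt[symmetric] powr_mult)
      \<comment> \<open>Raising the exponent of 3 and lowering that of \<open>x < 1\<close> both
        increase the product.\<close>
      also have "\<dots> \<le> 3 powr (2/3) * x powr (1/3)"
        using False x0 by (intro mult_mono powr_mono powr_mono') auto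
      finally show ?thesis .
    qed
    ultimately show ?thesis by linarith
  qed
  then show ?thesis by (simp only: rhs circuit_ensemble_def)
qed

end
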